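(* Every $\mathrm{L}_2$-convex polyhedron $P\subseteq\mathbb{R}^n$ is a box-TDI polyhedron. More generally, every $\mathrm{L}^\natural_2$-convex polyhedron $P\subseteq\mathbb{R}^n$ is a box-TDI polyhedron.
   Context: $x\vee y$, $x\wedge y$ denote componentwise maximum and minimum, $\mathbf{1}=(1,\ldots,1)$. A polyhedron $P\subseteq\mathbb{R}^n$ is L-convex if $x,y\in P$ implies $x\vee y,\ x\wedge y\in P$, and $x\in P,\ \mu\in\mathbb{R}$ implies $x+\mu\mathbf{1}\in P$. A polyhedron $P\subseteq\mathbb{R}^n$ is $\mathrm{L}^\natural$-convex if $P=\{x\in\mathbb{R}^n\mid(x,0)\in Q\}$ for some L-convex polyhedron $Q\subseteq\mathbb{R}^{n+1}$. A polyhedron $P\subseteq\mathbb{R}^n$ is $\mathrm{L}_2$-convex (resp. $\mathrm{L}^\natural_2$-convex) if it is the Minkowski sum of two L-convex (resp. $\mathrm{L}^\natural$-convex) polyhedra. A linear inequality system $Ax\le b$ is totally dual integral (TDI) if the entries of $A$ and $b$ are rational numbers and the minimum in the linear programming duality equation $\max\{c^\top x\mid Ax\le b\}=\min\{y^\top b\mid y^\top A=c^\top,\ y\ge0\}$ has an integral optimal solution $y$ for every integral vector $c$ such that the minimum is finite. The system $Ax\le b$ is box-totally dual integral (box-TDI) if the system $[Ax\le b,\ d\le x\le c]$ is TDI for each choice of rational (finite-valued) vectors $c$ and $d$. A polyhedron is called a box-TDI polyhedron if it can be described by a box-TDI system.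
   Formalization: P is additionally assumed to be rational (described by finitely many inequalities with rational data); otherwise the claim fails, e.g. for {x in R^2 : x1 - x2 <= sqrt 2}, and every box-TDI polyhedron is rational by definition. *)

theory Defs
  imports "HOL-Analysis.Analysis"
begin

section \<open>L-convex polyhedra and their relatives\<close>

text \<open>On \<^typ>\<open>real^'n\<close> the lattice operations \<^const>\<open>sup\<close> and \<^const>\<open>inf\<close> are the componentwise
  maximum and minimum, and \<^term>\<open>1 :: real^'n\<close> is the all-ones vector.
  The library predicate \<^const>\<open>polyhedron\<close> allows arbitrary real data, and it admits the empty set
  and the whole space.\<close>

definition L_convex :: "(real^'n) set \<Rightarrow> bool" where
  "L_convex P \<longleftrightarrow> polyhedron P
     \<and> (\<forall>x\<in>P. \<forall>y\<in>P. sup x y \<in> P \<and> inf x y \<in> P)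
     \<and> (\<forall>x\<in>P. \<forall>\<mu>::real. x + \<mu> *\<^sub>R 1 \<in> P)"

text \<open>The space of dimension \<open>n + 1\<close> is \<^typ>\<open>real^('n option)\<close>; the coordinate \<^const>\<open>None\<close> is the
  additional one, so \<open>append_zero x\<close> is the vector \<open>(x, 0)\<close>.\<close>

definition append_zero :: "real^'n \<Rightarrow> real^('n option)" where
  "append_zero x = (\<chi> i. case i of None \<Rightarrow> 0 | Some j \<Rightarrow> x $ j)"

definition L_natural_convex :: "(real^'n) set \<Rightarrow> bool" where
  "L_natural_convex P \<longleftrightarrow> polyhedron P
     \<and> (\<exists>Q :: (real^('n option)) set. L_convex Q \<and> P = {x. append_zero x \<in> Q})"

definition L2_convex :: "(real^'n) set \<Rightarrow> bool" where
  "L2_convex P \<longleftrightarrow> polyhedron P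
     \<and> (\<exists>P1 P2. L_convex P1 \<and> L_convex P2 \<and> P = {x + y | x y. x \<in> P1 \<and> y \<in> P2})"

definition L2_natural_convex :: "(real^'n) set \<Rightarrow> bool" where
  "L2_natural_convex P \<longleftrightarrow> polyhedron P
     \<and> (\<exists>P1 P2. L_natural_convex P1 \<and> L_natural_convex P2
            \<and> P = {x + y | x y. x \<in> P1 \<and> y \<in> P2})"


section \<open>Linear inequality systems and total dual integrality\<close>

text \<open>A system \<open>A x \<le> b\<close> is given by a finite set \<open>I\<close> of row indices, the rows \<open>A i\<close> and the
  right-hand sides \<open>b i\<close> for \<open>i \<in> I\<close>. The values of \<open>A\<close> and \<open>b\<close> outside \<open>I\<close> are irrelevant.\<close>

definition solutions :: "'i set \<Rightarrow> ('i \<Rightarrow> real^'n) \<Rightarrow> ('i \<Rightarrow> real) \<Rightarrow> (real^'n) set" where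
  "solutions I A b = {x. \<forall>i\<in>I. A i \<bullet> x \<le> b i}"

definition rational_system :: "'i set \<Rightarrow> ('i \<Rightarrow> real^'n) \<Rightarrow> ('i \<Rightarrow> real) \<Rightarrow> bool" where
  "rational_system I A b \<longleftrightarrow> finite I \<and> (\<forall>i\<in>I. (\<forall>j. A i $ j \<in> \<rat>) \<and> b i \<in> \<rat>)"

definition rational_polyhedron :: "(real^'n) set \<Rightarrow> bool" where
  "rational_polyhedron P \<longleftrightarrow>
     (\<exists>(m::nat) A b. rational_system {..<m} A b \<and> P = solutions {..<m} A b)"

text \<open>The dual of \<open>max {c\<^sup>T x | A x \<le> b}\<close> is \<open>min {y\<^sup>T b | y\<^sup>T A = c\<^sup>T, y \<ge> 0}\<close>.\<close>

definition dual_feasible :: "'i set \<Rightarrow> ('i \<Rightarrow> real^'n) \<Rightarrow> real^'n \<Rightarrow> ('i \<Rightarrow> real) \<Rightarrow> bool" where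
  "dual_feasible I A c y \<longleftrightarrow> (\<forall>i\<in>I. 0 \<le> y i) \<and> (\<Sum>i\<in>I. y i *\<^sub>R A i) = c"

definition dual_value :: "'i set \<Rightarrow> ('i \<Rightarrow> real) \<Rightarrow> ('i \<Rightarrow> real) \<Rightarrow> real" where
  "dual_value I b y = (\<Sum>i\<in>I. y i * b i)"

definition dual_optimal ::
    "'i set \<Rightarrow> ('i \<Rightarrow> real^'n) \<Rightarrow> ('i \<Rightarrow> real) \<Rightarrow> real^'n \<Rightarrow> ('i \<Rightarrow> real) \<Rightarrow> bool" where
  "dual_optimal I A b c y \<longleftrightarrow> dual_feasible I A c y
     \<and> (\<forall>z. dual_feasible I A c z \<longrightarrow> dual_value I b y \<le> dual_value I b z)"

text \<open>With the usual conventions the minimum is \<open>+\<infinity>\<close> if the dual program is infeasible and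
  \<open>-\<infinity>\<close> if it is unbounded.\<close>

definition dual_min_finite ::
    "'i set \<Rightarrow> ('i \<Rightarrow> real^'n) \<Rightarrow> ('i \<Rightarrow> real) \<Rightarrow> real^'n \<Rightarrow> bool" where
  "dual_min_finite I A b c \<longleftrightarrow>
     (\<exists>y. dual_feasible I A c y) \<and> bdd_below (dual_value I b ` {y. dual_feasible I A c y})"

definition TDI :: "'i set \<Rightarrow> ('i \<Rightarrow> real^'n) \<Rightarrow> ('i \<Rightarrow> real) \<Rightarrow> bool" where
  "TDI I A b \<longleftrightarrow> rational_system I A b
     \<and> (\<forall>c. (\<forall>j. c $ j \<in> \<int>) \<and> dual_min_finite I A b c
            \<longrightarrow> (\<exists>y. (\<forall>i\<in>I. y i \<in> \<int>) \<and> dual_optimal I A b c y))"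

text \<open>The system \<open>A x \<le> b, d \<le> x \<le> c\<close> has the rows of \<open>A x \<le> b\<close> (indices \<open>Inl i\<close>), the rows
  \<open>x\<^sub>j \<le> c\<^sub>j\<close> (indices \<open>Inr (Inl j)\<close>) and the rows \<open>- x\<^sub>j \<le> - d\<^sub>j\<close> (indices \<open>Inr (Inr j)\<close>).\<close>

definition box_index :: "'i set \<Rightarrow> ('i + 'n + 'n) set" where
  "box_index I = I <+> (UNIV <+> UNIV)"

definition box_rows :: "('i \<Rightarrow> real^'n) \<Rightarrow> 'i + 'n + 'n \<Rightarrow> real^'n" where
  "box_rows A = case_sum A (case_sum (\<lambda>j. axis j 1) (\<lambda>j. - axis j 1))"

definition box_rhs :: "('i \<Rightarrow> real) \<Rightarrow> real^'n \<Rightarrow> real^'n \<Rightarrow> 'i + 'n + 'n \<Rightarrow> real" where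
  "box_rhs b d c = case_sum b (case_sum (\<lambda>j. c $ j) (\<lambda>j. - d $ j))"

lemma solutions_box:
  "solutions (box_index I) (box_rows A) (box_rhs b d c) = solutions I A b \<inter> cbox d c"
  by (auto simp: solutions_def box_index_def box_rows_def box_rhs_def mem_box_cart
      inner_axis' Plus_def ball_Un)

definition box_TDI :: "'i set \<Rightarrow> ('i \<Rightarrow> real^'n) \<Rightarrow> ('i \<Rightarrow> real) \<Rightarrow> bool" where
  "box_TDI I A b \<longleftrightarrow>
     (\<forall>d c. (\<forall>j. d $ j \<in> \<rat>) \<and> (\<forall>j. c $ j \<in> \<rat>)
        \<longrightarrow> TDI (box_index I) (box_rows A) (box_rhs b d c))"

definition box_TDI_polyhedron :: "(real^'n) set \<Rightarrow> bool" where
  "box_TDI_polyhedron P \<longleftrightarrow>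
     (\<exists>(m::nat) A b. box_TDI {..<m} A b \<and> P = solutions {..<m} A b)"

end

theory Submission
  imports Defs
begin

text \<open>The summands of an \<open>L\<^sub>2\<close>-natural-convex polyhedron \<open>P = P\<^sub>1 + P\<^sub>2\<close> are given by bounds on potential
  differences \<open>x\<^sub>u - x\<^sub>v\<close>, with an additional node of potential \<open>0\<close>. Hence the normal cone of \<open>P\<close> at
  \<open>x\<^sub>1 + x\<^sub>2\<close> consists of the vectors that are the net outflow both of a nonnegative flow on the
  tight arcs at \<open>x\<^sub>1\<close> and of one on the tight arcs at \<open>x\<^sub>2\<close>. Such pairs of flows are circulations on two
  copies of the node set joined by an arc at every node, so they can be rounded to integral ones.
  Rounding \<open>p / M\<close> with \<open>M = max \<bar>p\<^sub>j\<bar>\<close> splits off a vector with entries in \<open>{-1, 0, 1}\<close> from an integral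
  normal vector \<open>p\<close>; so the integral normal vectors are nonnegative integral combinations of normal vectors
  of this kind, and these serve as the rows of the system. If an integral cost vector is maximized over
  \<open>P\<close> intersected with a box, rounding its component in the normal cone of \<open>P\<close> keeps the remainder in
  the normal cone of the box, which gives an integral dual solution.\<close>

section \<open>Linear programming\<close>

text \<open>A finitely generated convex cone is closed, so a \<open>q\<close> outside it is strictly
  separated from it by some \<open>w\<close>. Scaling elements of the cone shows that
  \<open>w\<close> is nonnegative on it, and then \<open>v = - w\<close> violates the
  hypothesis.\<close>

lemma Farkas:
  fixes a :: "'i \<Rightarrow> 'a::euclidean_space"
  assumes "finite I"
    and imp: "\<And>v. (\<And>i. i \<in> I \<Longrightarrow> a i \<bullet> v \<le> 0) \<Longrightarrow> q \<bullet> v \<le> 0"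
  obtains y where "\<And>i. i \<in> I \<Longrightarrow> 0 \<le> y i" "(\<Sum>i\<in>I. y i *\<^sub>R a i) = q"
proof -
  define K where "K = convex_cone hull (a ` I)"
  define C where "C = {\<Sum>i\<in>I. y i *\<^sub>R a i |y. \<forall>i\<in>I. 0 \<le> y i}"
  have C_I: "(\<Sum>i\<in>I. y i *\<^sub>R a i) \<in> C" if "\<And>i. i \<in> I \<Longrightarrow> 0 \<le> y i" for y
    unfolding C_def using that by (intro CollectI exI[of _ y]) auto
  have C_E: "\<exists>y. (\<forall>i\<in>I. 0 \<le> y i) \<and> x = (\<Sum>i\<in>I. y i *\<^sub>R a i)" if "x \<in> C" for x
    using that by (auto simp: C_def)
  have "convex_cone C"
    unfolding convex_cone_iff
  proof (intro conjI ballI allI impI)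
    show "0 \<in> C"
      using C_I[of "\<lambda>_. 0"] by simp
    show "x + y \<in> C" if "x \<in> C" "y \<in> C" for x y
    proof -
      obtain f g where "\<forall>i\<in>I. 0 \<le> f i" "x = (\<Sum>i\<in>I. f i *\<^sub>R a i)"
        "\<forall>i\<in>I. 0 \<le> g i" "y = (\<Sum>i\<in>I. g i *\<^sub>R a i)"
        using C_E[OF \<open>x \<in> C\<close>] C_E[OF \<open>y \<in> C\<close>] by metis
      then show ?thesis
        using C_I[of "\<lambda>i. f i + g i"] by (auto simp: scaleR_left_distrib sum.distrib)
    qed
    show "c *\<^sub>R x \<in> C" if "x \<in> C" "0 \<le> c" for x c
    proof -
      obtain f where "\<forall>i\<in>I. 0 \<le> f i" "x = (\<Sum>i\<in>I. f i *\<^sub>R a i)"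
        using C_E[OF \<open>x \<in> C\<close>] by metis
      then show ?thesis
        using C_I[of "\<lambda>i. c * f i"] that(2) by (auto simp: scaleR_sum_right)
    qed
  qed
  moreover have "a ` I \<subseteq> C"
  proof
    fix x assume "x \<in> a ` I"
    then obtain i where i: "i \<in> I" "x = a i" by blast
    have "(\<Sum>k\<in>I. (if k = i then 1 else 0) *\<^sub>R a k) = (\<Sum>k\<in>I. if k = i then a k else 0)"
      by (rule sum.cong) auto
    then have "(\<Sum>k\<in>I. (if k = i then 1 else 0) *\<^sub>R a k) = x"
      using i assms(1) by simp
    then show "x \<in> C"
      using C_I[of "\<lambda>k. if k = i then 1 else 0"] by auto
  qed
  ultimately have "K \<subseteq> C"
    unfolding K_def by (simp add: hull_minimal)
  have "q \<in> K"
  proof (rule ccontr)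
    assume "q \<notin> K"
    moreover have "convex K" "closed K"
      using assms(1) by (auto simp: K_def convex_convex_cone_hull closed_convex_cone_hull)
    ultimately obtain w \<beta> where w: "w \<bullet> q < \<beta>" "\<And>x. x \<in> K \<Longrightarrow> \<beta> < w \<bullet> x"
      using separating_hyperplane_closed_point by metis
    have "\<beta> < 0"
      using w(2)[of 0] by (simp add: K_def convex_cone_hull_contains_0)
    have "0 \<le> w \<bullet> x" if "x \<in> K" for x
    proof (rule ccontr)
      assume "\<not> 0 \<le> w \<bullet> x"
      then have neg: "w \<bullet> x < 0" by simp
      then have "(\<beta> / (w \<bullet> x)) *\<^sub>R x \<in> K"
        using \<open>\<beta> < 0\<close> that unfolding K_def
        by (intro convex_cone_hull_mul) (auto simp: divide_nonpos_neg)
      from w(2)[OF this] neg show False by simp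
    qed
    moreover have "a i \<in> K" if "i \<in> I" for i
      using that by (simp add: K_def hull_inc)
    ultimately have "q \<bullet> (- w) \<le> 0"
      by (intro imp) (simp add: inner_commute[of "a _" w])
    with w(1) \<open>\<beta> < 0\<close> show False by (simp add: inner_commute)
  qed
  with \<open>K \<subseteq> C\<close> C_E that show ?thesis
    by (metis subsetD)
qed

text \<open>A direction that is nonpositive on the rows tight at \<open>x\<close> stays feasible for
  small steps, so optimality bounds \<open>q\<close> on it, and \<open>Farkas\<close> for the tight
  rows yields the multipliers. All other rows get multiplier 0.\<close>

lemma complementary_slackness:
  fixes a :: "'i \<Rightarrow> 'a::euclidean_space"
  assumes "finite I"
    and feas: "\<And>i. i \<in> I \<Longrightarrow> a i \<bullet> x \<le> b i"
    and opt: "\<And>v. (\<And>i. i \<in> I \<Longrightarrow> a i \<bullet> v \<le> b i) \<Longrightarrow> q \<bullet> v \<le> q \<bullet> x"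
  obtains y where "\<And>i. i \<in> I \<Longrightarrow> 0 \<le> y i" "\<And>i. i \<in> I \<Longrightarrow> a i \<bullet> x < b i \<Longrightarrow> y i = 0"
    "(\<Sum>i\<in>I. y i *\<^sub>R a i) = q"
proof -
  define J where "J = {i\<in>I. a i \<bullet> x = b i}"
  have "finite J" using assms(1) by (simp add: J_def)
  moreover have "q \<bullet> v \<le> 0" if v: "\<And>i. i \<in> J \<Longrightarrow> a i \<bullet> v \<le> 0" for v
  proof -
    have "\<forall>\<^sub>F t in at_right (0::real). a i \<bullet> (x + t *\<^sub>R v) \<le> b i" if i: "i \<in> I" for i
    proof (cases "i \<in> J")
      case True
      have "\<forall>\<^sub>F t in at_right (0::real). 0 < t" by (simp add: eventually_at_right_less)
      then show ?thesis
      proof eventually_elim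
        case (elim t)
        then have "t * (a i \<bullet> v) \<le> 0" using v[OF True] by (simp add: mult_nonneg_nonpos)
        then show ?case using True by (simp add: J_def inner_add_right)
      qed
    next
      case False
      then have less: "a i \<bullet> x < b i" using feas[OF i] i by (auto simp: J_def)
      have "((\<lambda>t. a i \<bullet> (x + t *\<^sub>R v)) \<longlongrightarrow> a i \<bullet> (x + 0 *\<^sub>R v)) (at_right (0::real))"
        by (intro tendsto_intros)
      then have "\<forall>\<^sub>F t in at_right (0::real). a i \<bullet> (x + t *\<^sub>R v) < b i"
        using less by (intro order_tendstoD(2)) auto
      then show ?thesis by eventually_elim simp
    qed
    then have "\<forall>\<^sub>F t in at_right (0::real). \<forall>i\<in>I. a i \<bullet> (x + t *\<^sub>R v) \<le> b i"
      by (intro eventually_ball_finite assms(1) ballI)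
    moreover have "\<forall>\<^sub>F t in at_right (0::real). 0 < t" by (simp add: eventually_at_right_less)
    ultimately have "\<forall>\<^sub>F t in at_right (0::real). 0 < t \<and> q \<bullet> (x + t *\<^sub>R v) \<le> q \<bullet> x"
      by eventually_elim (use opt in blast)
    then obtain t :: real where "0 < t" "q \<bullet> (x + t *\<^sub>R v) \<le> q \<bullet> x"
      using eventually_happens[of _ "at_right (0::real)"] by auto
    then show ?thesis
      by (simp add: inner_add_right mult_le_0_iff)
  qed
  ultimately obtain y where y: "\<And>i. i \<in> J \<Longrightarrow> 0 \<le> y i" "(\<Sum>i\<in>J. y i *\<^sub>R a i) = q"
    using Farkas[of J a q] by metis
  have "(\<Sum>i\<in>I. (if i \<in> J then y i else 0) *\<^sub>R a i) = (\<Sum>i\<in>J. y i *\<^sub>R a i)"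
    using assms(1) by (intro sum.mono_neutral_cong_right) (auto simp: J_def)
  with y show ?thesis
    by (intro that[of "\<lambda>i. if i \<in> J then y i else 0"]) (auto simp: J_def)
qed

text \<open>Applied coordinatewise, a projection of \<open>\<real>\<close> onto \<open>\<rat>\<close> over the field \<open>\<rat>\<close> maps solutions of a
  rational linear equation system to rational solutions.\<close>

lemma real_to_rat_projection:
  obtains \<phi> :: "real \<Rightarrow> real"
  where "\<And>x. \<phi> x \<in> \<rat>" "\<And>x y. \<phi> (x + y) = \<phi> x + \<phi> y"
    "\<And>r x. r \<in> \<rat> \<Longrightarrow> \<phi> (r * x) = r * \<phi> x" "\<And>r. r \<in> \<rat> \<Longrightarrow> \<phi> r = r"
proof -
  interpret vector_space_pair "\<lambda>(q::rat) (x::real). of_rat q * x" "(*) :: rat \<Rightarrow> rat \<Rightarrow> rat"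
    by unfold_locales (auto simp: algebra_simps of_rat_add of_rat_mult)
  have "vs1.independent {1::real}"
    by (simp add: vs1.dependent_single)
  then obtain g :: "real \<Rightarrow> rat" where
    g: "Vector_Spaces.linear (\<lambda>(q::rat) (x::real). of_rat q * x) (*) g" "g 1 = 1"
    using linear_independent_extend[of "{1}" "\<lambda>_. 1"] by auto
  interpret g: Vector_Spaces.linear "\<lambda>(q::rat) (x::real). of_rat q * x" "(*)" g by (fact g(1))
  have scale: "real_of_rat (g (r * x)) = r * real_of_rat (g x)" if "r \<in> \<rat>" for r x
    using that by (auto simp: Rats_def g.scale of_rat_mult)
  show ?thesis
  proof (rule that[of "\<lambda>x. of_rat (g x)"])
    show "real_of_rat (g r) = r" if "r \<in> \<rat>" for r
      using scale[OF that, of 1] g(2) by simp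
  qed (auto simp: scale g.add of_rat_add)
qed

text \<open>The dual multipliers live on rows that are tight at \<open>x\<close> and have rational
  right-hand sides. Projecting \<open>x\<close> coordinatewise to a rational \<open>z\<close>
  preserves these equations and hence the objective value, although \<open>z\<close> may violate
  other inequalities.\<close>

lemma rational_system_optimum_in_Rats:
  fixes A :: "'i \<Rightarrow> real^'n"
  assumes rat: "rational_system I A b" and w: "\<And>j. w $ j \<in> \<rat>"
    and x: "x \<in> solutions I A b" and opt: "\<And>y. y \<in> solutions I A b \<Longrightarrow> w \<bullet> y \<le> w \<bullet> x"
  shows "w \<bullet> x \<in> \<rat>"
proof -
  obtain \<phi> :: "real \<Rightarrow> real" where
    \<phi>: "\<And>x. \<phi> x \<in> \<rat>" "\<And>x y. \<phi> (x + y) = \<phi> x + \<phi> y"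
    "\<And>r x. r \<in> \<rat> \<Longrightarrow> \<phi> (r * x) = r * \<phi> x" "\<And>r. r \<in> \<rat> \<Longrightarrow> \<phi> r = r"
    by (rule real_to_rat_projection) blast
  have "finite I" using rat by (simp add: rational_system_def)
  obtain y where y: "\<And>i. i \<in> I \<Longrightarrow> 0 \<le> y i" "\<And>i. i \<in> I \<Longrightarrow> A i \<bullet> x < b i \<Longrightarrow> y i = 0"
    "(\<Sum>i\<in>I. y i *\<^sub>R A i) = w"
    by (rule complementary_slackness[OF \<open>finite I\<close>, of A x b w])
      (use x opt in \<open>auto simp: solutions_def\<close>)
  define z :: "real^'n" where "z = (\<chi> j. \<phi> (x $ j))"
  have \<phi>_sum: "\<phi> (sum h S) = (\<Sum>s\<in>S. \<phi> (h s))" if "finite S" for h :: "'b \<Rightarrow> real" and S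
    using that by (induction S) (auto simp: \<phi>(2) \<phi>(4))
  have \<phi>_inner: "v \<bullet> z = \<phi> (v \<bullet> x)" if "\<And>j. v $ j \<in> \<rat>" for v
    using that by (simp add: inner_vec_def z_def \<phi>_sum \<phi>(3))
  have "A i \<bullet> z = A i \<bullet> x" if "i \<in> I" "y i \<noteq> 0" for i
  proof -
    have "A i \<bullet> x = b i"
      using that y(2) x by (force simp: solutions_def)
    moreover have "b i \<in> \<rat>" "\<And>j. A i $ j \<in> \<rat>"
      using that rat by (auto simp: rational_system_def)
    ultimately show ?thesis by (simp add: \<phi>_inner \<phi>(4))
  qed
  then have "w \<bullet> z = w \<bullet> x"
    unfolding y(3)[symmetric] inner_sum_left
    by (intro sum.cong) auto
  then show ?thesis
    using \<phi>_inner[OF w] \<phi>(1) by metis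
qed

section \<open>Integral flows\<close>

text \<open>Stated for indexed families because parallel arcs have equal incidence vectors: a
  repetition is itself a dependence, and without repetitions the family is larger than a set whose
  span contains it.\<close>

lemma scaleR_linear_dependence:
  fixes u :: "'e \<Rightarrow> 'a::euclidean_space"
  assumes "finite F" and S: "finite S" "card S < card F" "u ` F \<subseteq> span S"
  obtains z where "(\<Sum>e\<in>F. z e *\<^sub>R u e) = 0" "\<exists>e\<in>F. z e \<noteq> 0"
proof (cases "inj_on u F")
  case True
  have "dependent (u ` F)"
  proof (rule ccontr)
    assume "independent (u ` F)"
    then have "card (u ` F) \<le> card S"
      using independent_span_bound[OF S(1) _ S(3)] by auto
    with True S(2) show False by (simp add: card_image)
  qed
  then obtain c where "(\<Sum>v\<in>u ` F. c v *\<^sub>R v) = 0" "\<exists>v\<in>u ` F. c v \<noteq> 0"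
    using assms(1) by (auto simp: dependent_finite)
  then show ?thesis
    using True by (intro that[of "c \<circ> u"]) (auto simp: sum.reindex)
next
  case False
  then obtain e e' where e: "e \<in> F" "e' \<in> F" "e \<noteq> e'" "u e = u e'"
    by (auto simp: inj_on_def)
  let ?z = "\<lambda>k. if k = e then 1 else if k = e' then - 1 else (0::real)"
  have "(\<Sum>k\<in>F. ?z k *\<^sub>R u k) = (\<Sum>k\<in>{e, e'}. ?z k *\<^sub>R u k)"
    using assms(1) e by (intro sum.mono_neutral_right) auto
  then have "(\<Sum>k\<in>F. ?z k *\<^sub>R u k) = 0"
    using e by simp
  with e show ?thesis by (intro that[of ?z]) auto
qed

lemma push_to_integer:
  fixes f z :: "'e \<Rightarrow> real"
  assumes "finite F" and frac: "\<And>e. e \<in> F \<Longrightarrow> f e \<notin> \<int>" and z: "\<exists>e\<in>F. z e \<noteq> 0"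
  obtains t where "\<And>e. e \<in> F \<Longrightarrow> of_int \<lfloor>f e\<rfloor> \<le> f e + t * z e"
    "\<And>e. e \<in> F \<Longrightarrow> f e + t * z e \<le> of_int \<lceil>f e\<rceil>" "\<exists>e\<in>F. f e + t * z e \<in> \<int>"
proof -
  \<comment> \<open>The step length at which coordinate \<open>e\<close> reaches the next integer in
    its direction of motion. Their minimum \<open>t\<close> makes some coordinate integral before
    any coordinate passes an integer.\<close>
  define \<tau> where "\<tau> e = ((if 0 < z e then of_int \<lceil>f e\<rceil> else of_int \<lfloor>f e\<rfloor>) - f e) / z e" for e
  define t where "t = Min (\<tau> ` {e\<in>F. z e \<noteq> 0})"
  have fin: "finite (\<tau> ` {e\<in>F. z e \<noteq> 0})" "\<tau> ` {e\<in>F. z e \<noteq> 0} \<noteq> {}"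
    using assms(1) z by auto
  have t_le: "t \<le> \<tau> e" if "e \<in> F" "z e \<noteq> 0" for e
    unfolding t_def using fin that by (intro Min_le) auto
  obtain e where e: "e \<in> F" "z e \<noteq> 0" "t = \<tau> e"
    using Min_in[OF fin] unfolding t_def by auto
  have "0 \<le> \<tau> e" for e
    by (auto simp: \<tau>_def divide_nonneg_pos divide_nonpos_nonpos)
  then have "0 \<le> t" using e(3) by simp
  have bounds: "of_int \<lfloor>f k\<rfloor> \<le> f k + t * z k \<and> f k + t * z k \<le> of_int \<lceil>f k\<rceil>" if k: "k \<in> F" for k
  proof -
    consider "z k = 0" | "0 < z k" | "z k < 0" by linarith
    then show ?thesis
    proof cases
      case 1 then show ?thesis by simp
    next
      case 2
      then have "t * z k \<le> \<tau> k * z k" using t_le[OF k] by (simp add: mult_right_mono)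
      moreover have "\<tau> k * z k = of_int \<lceil>f k\<rceil> - f k" using 2 by (simp add: \<tau>_def)
      moreover have "0 \<le> t * z k" using 2 \<open>0 \<le> t\<close> by simp
      ultimately show ?thesis using of_int_floor_le[of "f k"] by linarith
    next
      case 3
      then have "\<tau> k * z k \<le> t * z k" using t_le[OF k] by (simp add: mult_right_mono_neg)
      moreover have "\<tau> k * z k = of_int \<lfloor>f k\<rfloor> - f k" using 3 by (simp add: \<tau>_def)
      moreover have "t * z k \<le> 0" using 3 \<open>0 \<le> t\<close> by (simp add: mult_nonneg_nonpos)
      ultimately show ?thesis using le_of_int_ceiling[of "f k"] by linarith
    qed
  qed
  have "f e + t * z e \<in> \<int>"
    using e by (simp add: \<tau>_def)
  with e bounds show ?thesis by (intro that[of t]) auto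
qed

text \<open>Induction on the number of fractional arcs. A linear dependence among their incidence
  vectors is a direction that changes no net outflow; moving along it until some arc becomes
  integral keeps every value between its old floor and ceiling.\<close>

lemma flow_rounding:
  fixes tl hd :: "'e \<Rightarrow> 'v::finite" and f :: "'e \<Rightarrow> real"
  assumes "finite E"
    and "\<And>v. (\<Sum>e\<in>E. f e * (of_bool (tl e = v) - of_bool (hd e = v))) \<in> \<int>"
  shows "\<exists>g. (\<forall>e\<in>E. g e \<in> \<int> \<and> of_int \<lfloor>f e\<rfloor> \<le> g e \<and> g e \<le> of_int \<lceil>f e\<rceil>)
    \<and> (\<forall>v. (\<Sum>e\<in>E. g e * (of_bool (tl e = v) - of_bool (hd e = v)))
          = (\<Sum>e\<in>E. f e * (of_bool (tl e = v) - of_bool (hd e = v))))"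
  using assms(2)
proof (induction "card {e\<in>E. f e \<notin> \<int>}" arbitrary: f rule: less_induct)
  case less
  define F where "F = {e\<in>E. f e \<notin> \<int>}"
  define u :: "'e \<Rightarrow> real^'v" where "u e = axis (tl e) 1 - axis (hd e) 1" for e
  have u_nth: "u e $ v = of_bool (tl e = v) - of_bool (hd e = v)" for e v
    by (simp add: u_def axis_def)
  have "finite F" using assms(1) by (simp add: F_def)
  show ?case
  proof (cases "F = {}")
    case True
    then have "\<forall>e\<in>E. f e \<in> \<int>" by (auto simp: F_def)
    then show ?thesis by (intro exI[of _ f]) auto
  next
    case False
    \<comment> \<open>Every node met by a fractional arc meets at least two of them, so there are at least as many
      fractional arcs as such nodes, whereas incidence vectors of arcs have coordinate sum 0.\<close>
    have "\<exists>z. (\<Sum>e\<in>F. z e *\<^sub>R u e) = 0 \<and> (\<exists>e\<in>F. z e \<noteq> 0)"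
    proof (cases "\<exists>e\<in>F. tl e = hd e")
      case True
      then obtain e where e: "e \<in> F" "tl e = hd e" by blast
      then have "(\<Sum>k\<in>F. of_bool (k = e) *\<^sub>R u k) = 0"
        by (intro sum.neutral) (auto simp: u_def)
      with e show ?thesis by (intro exI[of _ "\<lambda>k. of_bool (k = e)"]) auto
    next
      case no_loop: False
      define V where "V = tl ` F \<union> hd ` F"
      define D where "D v = {e\<in>F. tl e = v \<or> hd e = v}" for v
      have "finite V" using \<open>finite F\<close> by (simp add: V_def)
      have D2: "2 \<le> card (D v)" if "v \<in> V" for v
      proof (rule ccontr)
        assume "\<not> 2 \<le> card (D v)"
        moreover have "finite (D v)" using \<open>finite F\<close> by (simp add: D_def)
        moreover have "D v \<noteq> {}" using that by (auto simp: V_def D_def)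
        ultimately have "card (D v) = 1"
          by (metis One_nat_def card_0_eq less_2_cases not_le)
        then obtain e where e: "D v = {e}" by (rule card_1_singletonE)
        then have eE: "e \<in> E" "e \<in> F" and "tl e = v \<or> hd e = v" by (auto simp: D_def F_def)
        moreover have "tl e \<noteq> hd e" using no_loop eE by auto
        ultimately have sgn: "u e $ v = 1 \<or> u e $ v = - 1" by (auto simp: u_nth)
        \<comment> \<open>If \<open>e\<close> were the only fractional arc at \<open>v\<close>, all
          other terms of the integral net outflow at \<open>v\<close> would be integers, and so
          would \<open>f e\<close>.\<close>
        have "(\<Sum>k\<in>E. f k * u k $ v) = f e * u e $ v + (\<Sum>k\<in>E-{e}. f k * u k $ v)"
          using eE assms(1) by (simp add: sum.remove)
        moreover have "(\<Sum>k\<in>E-{e}. f k * u k $ v) \<in> \<int>"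
        proof (rule Ints_sum)
          fix k assume k: "k \<in> E - {e}"
          show "f k * u k $ v \<in> \<int>"
          proof (cases "k \<in> F")
            case True
            then have "k \<notin> D v" using e k by auto
            then show ?thesis using True by (simp add: D_def u_nth)
          next
            case False
            then show ?thesis using k by (auto simp: F_def u_nth intro!: Ints_mult Ints_diff)
          qed
        qed
        moreover have "(\<Sum>k\<in>E. f k * u k $ v) \<in> \<int>"
          using less.prems[of v] by (simp add: u_nth)
        ultimately have "f e * u e $ v \<in> \<int>"
          by (metis Ints_diff add_diff_cancel_right')
        then have "f e \<in> \<int>" using sgn by auto
        then show False using eE by (simp add: F_def)
      qed
      \<comment> \<open>Double counting of incidences: without loops, each fractional arc has
        exactly two end nodes.\<close>
      have "2 * card V = (\<Sum>v\<in>V. 2)" by simp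
      also have "\<dots> \<le> (\<Sum>v\<in>V. card (D v))" by (intro sum_mono D2)
      also have "\<dots> = (\<Sum>v\<in>V. \<Sum>e\<in>F. of_bool (tl e = v) + of_bool (hd e = v))"
      proof (rule sum.cong[OF refl])
        fix v assume "v \<in> V"
        have "card (D v) = (\<Sum>e\<in>F. of_bool (tl e = v \<or> hd e = v))"
          using \<open>finite F\<close> by (simp add: D_def Int_def del: of_bool_or_iff)
        also have "\<dots> = (\<Sum>e\<in>F. of_bool (tl e = v) + of_bool (hd e = v))"
          using no_loop by (intro sum.cong) auto
        finally show "card (D v) = (\<Sum>e\<in>F. of_bool (tl e = v) + of_bool (hd e = v))" .
      qed
      also have "\<dots> = (\<Sum>e\<in>F. \<Sum>v\<in>V. of_bool (tl e = v) + of_bool (hd e = v))"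
        by (rule sum.swap)
      also have "\<dots> = (\<Sum>e\<in>F. 2)"
      proof (rule sum.cong[OF refl])
        fix e assume "e \<in> F"
        then have "tl e \<in> V" "hd e \<in> V" by (auto simp: V_def)
        then have "V \<inter> {v. tl e = v} = {tl e}" "V \<inter> {v. hd e = v} = {hd e}" by auto
        then show "(\<Sum>v\<in>V. of_bool (tl e = v) + of_bool (hd e = v)) = (2::nat)"
          using \<open>finite V\<close> by (simp add: sum.distrib)
      qed
      finally have VF: "card V \<le> card F" by simp
      obtain r where r: "r \<in> V" using False by (auto simp: V_def)
      \<comment> \<open>Differences to a fixed root \<open>r\<close>. There are fewer of them than
        nodes in \<open>V\<close>, and every incidence vector of an arc in \<open>F\<close> is a
        difference of two of them or of one of them and 0.\<close>
      define S where "S = (\<lambda>v. axis v 1 - axis r (1::real)) ` (V - {r})"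
      have "card S \<le> card (V - {r})"
        unfolding S_def using \<open>finite V\<close> by (intro card_image_le) simp
      also have "\<dots> < card F"
        using VF r \<open>finite V\<close> by (metis card_Diff1_less less_le_trans)
      finally have "card S < card F" .
      moreover have "finite S" using \<open>finite V\<close> by (simp add: S_def)
      moreover have "u ` F \<subseteq> span S"
      proof
        have in_span: "axis v 1 - axis r (1::real) \<in> span S" if "v \<in> V" for v
          using that by (cases "v = r") (auto simp: S_def span_0 intro!: span_base)
        fix y assume "y \<in> u ` F"
        then obtain e where e: "e \<in> F" "y = u e" by blast
        have "y = (axis (tl e) 1 - axis r 1) - (axis (hd e) 1 - axis r 1)"
          using e by (simp add: u_def)
        moreover have "tl e \<in> V" "hd e \<in> V" using e by (auto simp: V_def)
        ultimately show "y \<in> span S"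
          by (metis in_span span_diff)
      qed
      ultimately show ?thesis
        using scaleR_linear_dependence[OF \<open>finite F\<close>, of S u] by metis
    qed
    then obtain z where z: "(\<Sum>e\<in>F. z e *\<^sub>R u e) = 0" "\<exists>e\<in>F. z e \<noteq> 0" by blast
    obtain t where t: "\<And>e. e \<in> F \<Longrightarrow> of_int \<lfloor>f e\<rfloor> \<le> f e + t * z e"
      "\<And>e. e \<in> F \<Longrightarrow> f e + t * z e \<le> of_int \<lceil>f e\<rceil>" "\<exists>e\<in>F. f e + t * z e \<in> \<int>"
      using push_to_integer[OF \<open>finite F\<close> _ z(2), of f] by (auto simp: F_def)
    define f' where "f' e = (if e \<in> F then f e + t * z e else f e)" for e
    have f'_bounds: "of_int \<lfloor>f e\<rfloor> \<le> f' e" "f' e \<le> of_int \<lceil>f e\<rceil>" for e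
      using t by (auto simp: f'_def)
    have same: "(\<Sum>e\<in>E. f' e * (of_bool (tl e = v) - of_bool (hd e = v)))
          = (\<Sum>e\<in>E. f e * (of_bool (tl e = v) - of_bool (hd e = v)))" for v
    proof -
      have "(\<Sum>e\<in>E. f' e * u e $ v) - (\<Sum>e\<in>E. f e * u e $ v)
          = (\<Sum>e\<in>E. if e \<in> F then t * z e * u e $ v else 0)"
        unfolding sum_subtractf[symmetric] by (intro sum.cong) (auto simp: f'_def algebra_simps)
      also have "\<dots> = (\<Sum>e\<in>F. t * z e * u e $ v)"
        using assms(1) by (intro sum.mono_neutral_cong_right) (auto simp: F_def)
      also have "\<dots> = t * (\<Sum>e\<in>F. z e *\<^sub>R u e) $ v"
        by (simp add: sum_distrib_left mult.assoc)
      also have "\<dots> = 0" using z by simp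
      finally show ?thesis by (simp add: u_nth)
    qed
    have "{e\<in>E. f' e \<notin> \<int>} \<subset> {e\<in>E. f e \<notin> \<int>}"
      using t(3) by (auto simp: f'_def F_def)
    then have "card {e\<in>E. f' e \<notin> \<int>} < card {e\<in>E. f e \<notin> \<int>}"
      using assms(1) by (intro psubset_card_mono) auto
    then obtain g where g: "\<forall>e\<in>E. g e \<in> \<int> \<and> of_int \<lfloor>f' e\<rfloor> \<le> g e \<and> g e \<le> of_int \<lceil>f' e\<rceil>"
      "\<forall>v. (\<Sum>e\<in>E. g e * (of_bool (tl e = v) - of_bool (hd e = v)))
          = (\<Sum>e\<in>E. f' e * (of_bool (tl e = v) - of_bool (hd e = v)))"
      using less.hyps[of f'] less.prems by (auto simp: same)
    \<comment> \<open>Since \<open>f'\<close> stays within the floors and ceilings of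
      \<open>f\<close>, a rounding of \<open>f'\<close> is also a rounding of
      \<open>f\<close>.\<close>
    moreover have "of_int \<lfloor>f e\<rfloor> \<le> (of_int \<lfloor>f' e\<rfloor> :: real)" "of_int \<lceil>f' e\<rceil> \<le> (of_int \<lceil>f e\<rceil> :: real)" for e
      using f'_bounds[of e] by (simp_all add: le_floor_iff ceiling_le_iff)
    ultimately show ?thesis
      by (intro exI[of _ g] conjI ballI allI) (auto simp: same simp del: of_int_le_iff intro: order_trans)
  qed
qed

section \<open>Potential differences and flow cones\<close>

text \<open>\<open>E\<close> collects the pairs whose difference is bounded above on
  \<open>Q\<close>, and \<open>\<gamma>\<close> is the least bound. Shifts and lattice operations
  produce points of \<open>Q\<close> arbitrarily close to any \<open>y\<close> obeying these bounds,
  and \<open>Q\<close> is closed.\<close>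

lemma L_convex_differences:
  fixes Q :: "(real^'v) set"
  assumes "L_convex Q" "Q \<noteq> {}"
  obtains E \<gamma> where "Q = {x. \<forall>(u, v)\<in>E. x $ u - x $ v \<le> \<gamma> u v}"
proof -
  have closed: "closed Q" using assms(1) by (auto simp: L_convex_def polyhedron_imp_closed)
  have lattice: "sup x y \<in> Q" "inf x y \<in> Q" if "x \<in> Q" "y \<in> Q" for x y
    using assms(1) that by (auto simp: L_convex_def)
  have shift: "x + \<mu> *\<^sub>R 1 \<in> Q" if "x \<in> Q" for x \<mu>
    using assms(1) that by (auto simp: L_convex_def)
  define E where "E = {(u, v). bdd_above ((\<lambda>x. x $ u - x $ v) ` Q)}"
  define \<gamma> where "\<gamma> u v = (SUP x\<in>Q. x $ u - x $ v)" for u v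
  have "y \<in> Q" if y: "\<forall>(u, v)\<in>E. y $ u - y $ v \<le> \<gamma> u v" for y
  proof -
    \<comment> \<open>For each pair \<open>u\<close>, \<open>v\<close> some point of \<open>Q\<close> equals \<open>y\<close> at \<open>u\<close> and is at most \<open>y + e\<close> at \<open>v\<close>; take the
      infimum of these points over \<open>v\<close> and then the supremum over \<open>u\<close>.\<close>
    have near: "\<exists>x\<in>Q. \<forall>v. y $ v \<le> x $ v \<and> x $ v \<le> y $ v + e" if "0 < e" for e
    proof -
      have two: "\<exists>x\<in>Q. x $ u = y $ u \<and> x $ v \<le> y $ v + e" for u v
      proof -
        have "\<exists>x\<in>Q. y $ u - y $ v - e < x $ u - x $ v"
        proof (cases "(u, v) \<in> E")
          case True
          then have "y $ u - y $ v - e < \<gamma> u v" using y that by fastforce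
          with True assms(2) show ?thesis
            unfolding \<gamma>_def E_def by (subst (asm) less_cSUP_iff) auto
        next
          case False
          then show ?thesis
            by (auto simp: E_def bdd_above_def not_le)
        qed
        then obtain x where x: "x \<in> Q" "y $ u - y $ v - e < x $ u - x $ v" by blast
        \<comment> \<open>Shifting by a multiple of the all-ones vector keeps the difference and
          makes coordinate \<open>u\<close> agree with that of \<open>y\<close>.\<close>
        show ?thesis
          using shift[OF x(1), of "y $ u - x $ u"] x(2) by (intro bexI) auto
      qed
      have below: "\<exists>x\<in>Q. x $ u = y $ u \<and> (\<forall>v\<in>T. x $ v \<le> y $ v + e)" if "finite T" for u T
        using that
      proof (induction T)
        case empty
        then show ?case using two by auto
      next
        case (insert v T)
        then obtain x where x: "x \<in> Q" "x $ u = y $ u" "\<forall>v\<in>T. x $ v \<le> y $ v + e" by auto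
        obtain x' where x': "x' \<in> Q" "x' $ u = y $ u" "x' $ v \<le> y $ v + e" using two by blast
        show ?case
          using lattice(2)[OF x(1) x'(1)] x x'
          by (intro bexI[of _ "inf x x'"]) (auto simp: inf_vec_def intro: le_infI1 le_infI2)
      qed
      have "\<exists>x\<in>Q. (\<forall>v\<in>T. y $ v \<le> x $ v) \<and> (\<forall>v. x $ v \<le> y $ v + e)" if "finite T" for T
        using that
      proof (induction T)
        case empty
        then show ?case using below[of UNIV] by auto
      next
        case (insert u T)
        then obtain x where x: "x \<in> Q" "\<forall>v\<in>T. y $ v \<le> x $ v" "\<forall>v. x $ v \<le> y $ v + e" by auto
        obtain x' where x': "x' \<in> Q" "x' $ u = y $ u" "\<forall>v. x' $ v \<le> y $ v + e"
          using below[of UNIV] by auto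
        show ?case
          using lattice(1)[OF x(1) x'(1)] x x'
          by (intro bexI[of _ "sup x x'"]) (auto simp: sup_vec_def intro: le_supI1 le_supI2)
      qed
      from this[of UNIV] show ?thesis by auto
    qed
    have "\<exists>x\<in>Q. dist x y < \<epsilon>" if "0 < \<epsilon>" for \<epsilon>
    proof -
      define e where "e = \<epsilon> / (2 * real CARD('v))"
      have "0 < e" using that by (simp add: e_def)
      then obtain x where x: "x \<in> Q" "\<And>v. y $ v \<le> x $ v \<and> x $ v \<le> y $ v + e" using near by blast
      have "dist x y \<le> (\<Sum>v\<in>UNIV. \<bar>(x - y) $ v\<bar>)"
        unfolding dist_norm by (rule norm_le_l1_cart)
      also have "\<dots> \<le> (\<Sum>v\<in>(UNIV::'v set). e)"
        using x(2) by (intro sum_mono) (auto simp: abs_le_iff algebra_simps add_increasing)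
      also have "\<dots> = \<epsilon> / 2" by (simp add: e_def)
      also have "\<dots> < \<epsilon>" using that by simp
      finally show ?thesis using x(1) by blast
    qed
    then show ?thesis using closed closed_approachable by metis
  qed
  moreover have "x $ u - x $ v \<le> \<gamma> u v" if "x \<in> Q" "(u, v) \<in> E" for x u v
    using that unfolding E_def \<gamma>_def by (intro cSUP_upper) auto
  ultimately have "Q = {x. \<forall>(u, v)\<in>E. x $ u - x $ v \<le> \<gamma> u v}"
    by auto
  then show ?thesis by (rule that)
qed

text \<open>Bounds on a single coordinate are the arcs between \<open>Some j\<close> and
  \<open>None\<close>.\<close>

definition potential_polyhedron ::
    "('n option \<times> 'n option) set \<Rightarrow> ('n option \<Rightarrow> 'n option \<Rightarrow> real) \<Rightarrow> (real^'n) set" where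
  "potential_polyhedron E \<gamma> = {x. \<forall>(u, v)\<in>E. append_zero x $ u - append_zero x $ v \<le> \<gamma> u v}"

lemma append_zero_nth [simp]:
  "append_zero x $ None = 0" "append_zero x $ Some j = x $ j"
  by (simp_all add: append_zero_def)

lemma L_natural_convex_differences:
  fixes P :: "(real^'n) set"
  assumes "L_natural_convex P" "P \<noteq> {}"
  obtains E \<gamma> where "P = potential_polyhedron E \<gamma>"
proof -
  obtain Q :: "(real^('n option)) set" where Q: "L_convex Q" "P = {x. append_zero x \<in> Q}"
    using assms(1) by (auto simp: L_natural_convex_def)
  moreover from Q assms(2) have "Q \<noteq> {}" by auto
  ultimately obtain E \<gamma> where "Q = {x. \<forall>(u, v)\<in>E. x $ u - x $ v \<le> \<gamma> u v}"
    using L_convex_differences by blast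
  with Q(2) have "P = potential_polyhedron E \<gamma>"
    by (simp add: potential_polyhedron_def)
  then show ?thesis by (rule that)
qed

text \<open>The required L-convex set is the cylinder over \<open>P\<close>, the preimage under
  forgetting the \<open>None\<close> coordinate. This projection is linear, commutes with the
  lattice operations and preserves the all-ones vector; the adjoint turns preimages of half-spaces
  into single linear inequalities.\<close>

lemma L_convex_imp_L_natural_convex:
  fixes P :: "(real^'n) set"
  assumes "L_convex P"
  shows "L_natural_convex P"
proof -
  define tail :: "real^('n option) \<Rightarrow> real^'n" where "tail z = (\<chi> j. z $ Some j)" for z
  have "linear tail" by (intro linearI) (simp_all add: tail_def vec_eq_iff)
  have "polyhedron (tail -` P)"
  proof -
    obtain F where F: "finite F" "P = \<Inter>F" "\<forall>h\<in>F. \<exists>a b. a \<noteq> 0 \<and> h = {x. a \<bullet> x \<le> b}"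
      using assms by (auto simp: L_convex_def polyhedron_def)
    have "polyhedron (tail -` h)" if h: "h \<in> F" for h
    proof -
      obtain a b where "h = {x. a \<bullet> x \<le> b}" using F(3) h by blast
      then have "tail -` h = {z. adjoint tail a \<bullet> z \<le> b}"
        using adjoint_works[OF \<open>linear tail\<close>] by (auto simp: inner_commute)
      then show ?thesis by (simp add: polyhedron_halfspace_le)
    qed
    moreover have "tail -` P = \<Inter>((\<lambda>h. tail -` h) ` F)" using F(2) by auto
    ultimately show ?thesis using F(1) by (auto intro!: polyhedron_Inter)
  qed
  moreover have "tail (sup x y) = sup (tail x) (tail y)" "tail (inf x y) = inf (tail x) (tail y)" for x y
    by (simp_all add: tail_def vec_eq_iff sup_vec_def inf_vec_def)
  moreover have "tail (x + \<mu> *\<^sub>R 1) = tail x + \<mu> *\<^sub>R 1" for x \<mu>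
    by (simp add: tail_def vec_eq_iff)
  ultimately have "L_convex (tail -` P)"
    using assms by (simp add: L_convex_def)
  moreover have "tail (append_zero x) = x" for x
    by (simp add: tail_def vec_eq_iff)
  ultimately show ?thesis
    using assms unfolding L_natural_convex_def
    by (intro conjI exI[of _ "tail -` P"]) (auto simp: L_convex_def)
qed

section \<open>Net outflow and simultaneous rounding of two flows\<close>

definition netout :: "('v::finite \<Rightarrow> 'v \<Rightarrow> real) \<Rightarrow> 'v \<Rightarrow> real" where
  "netout f v = (\<Sum>w\<in>UNIV. f v w) - (\<Sum>w\<in>UNIV. f w v)"

text \<open>Summation by parts, the link between flows and the potential differences that define the
  polyhedra.\<close>

lemma sum_netout_mult:
  "(\<Sum>v\<in>UNIV. netout f v * h v) = (\<Sum>u\<in>UNIV. \<Sum>v\<in>UNIV. f u v * (h u - h v))"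
proof -
  have "(\<Sum>v\<in>UNIV. netout f v * h v)
      = (\<Sum>u\<in>UNIV. \<Sum>v\<in>UNIV. f u v * h u) - (\<Sum>v\<in>UNIV. \<Sum>u\<in>UNIV. f u v * h v)"
    by (simp add: netout_def left_diff_distrib sum_subtractf sum_distrib_right)
  also have "(\<Sum>v\<in>UNIV. \<Sum>u\<in>UNIV. f u v * h v) = (\<Sum>u\<in>UNIV. \<Sum>v\<in>UNIV. f u v * h v)"
    by (rule sum.swap)
  finally show ?thesis by (simp add: right_diff_distrib sum_subtractf)
qed

lemma sum_netout: "(\<Sum>v\<in>UNIV. netout f v) = 0"
  using sum_netout_mult[of f "\<lambda>_. 1"] by simp

text \<open>With this, equality of two net outflows need only be checked at the nodes
  \<open>Some j\<close>.\<close>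

lemma netout_None: "netout f None = - (\<Sum>j\<in>UNIV. netout f (Some j))"
  using sum_netout[of f] by (simp add: UNIV_option_conv sum.reindex)

lemma netout_diff: "netout (\<lambda>u v. f u v - g u v) v = netout f v - netout g v"
  by (simp add: netout_def sum_subtractf)

lemma netout_mult: "netout (\<lambda>u v. c * f u v) v = c * netout f v"
  by (simp add: netout_def sum_distrib_left right_diff_distrib)

text \<open>Either direction is allowed. What matters is that integer bounds on \<open>x\<close>
  carry over to \<open>y\<close>, so that nonnegativity and integral values survive.\<close>

definition rounding :: "real \<Rightarrow> real \<Rightarrow> bool" where
  "rounding x y \<longleftrightarrow> y \<in> \<int> \<and> of_int \<lfloor>x\<rfloor> \<le> y \<and> y \<le> of_int \<lceil>x\<rceil>"

lemma rounding_ge: "rounding x y \<Longrightarrow> m \<in> \<int> \<Longrightarrow> m \<le> x \<Longrightarrow> m \<le> y"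
  by (auto simp: rounding_def Ints_def le_floor_iff[symmetric])

lemma rounding_le: "rounding x y \<Longrightarrow> m \<in> \<int> \<Longrightarrow> x \<le> m \<Longrightarrow> y \<le> m"
  by (auto simp: rounding_def Ints_def ceiling_le_iff[symmetric])

lemma rounding_eq: "rounding x y \<Longrightarrow> x \<in> \<int> \<Longrightarrow> y = x"
  using rounding_ge[of x y x] rounding_le[of x y x] by auto

lemma rounding_dist: "rounding x y \<Longrightarrow> \<bar>y - x\<bar> \<le> 1"
  unfolding rounding_def by linarith

lemma common_netout_rounding:
  fixes f g :: "'v::finite \<Rightarrow> 'v \<Rightarrow> real"
  assumes "netout f = netout g"
  obtains f' g' where "\<And>u v. rounding (f u v) (f' u v)" "\<And>u v. rounding (g u v) (g' u v)"
    "netout f' = netout g'" "\<And>v. rounding (netout f v) (netout f' v)"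
proof -
  \<comment> \<open>The second copy of the arc set is reversed, and the common net outflow at \<open>v\<close> runs from the
    second copy of \<open>v\<close> to the first.\<close>
  define tl :: "('v \<times> 'v) + ('v \<times> 'v) + 'v \<Rightarrow> 'v + 'v" where
    "tl = case_sum (\<lambda>(u, v). Inl u) (case_sum (\<lambda>(u, v). Inr v) (\<lambda>v. Inr v))"
  define hd :: "('v \<times> 'v) + ('v \<times> 'v) + 'v \<Rightarrow> 'v + 'v" where
    "hd = case_sum (\<lambda>(u, v). Inl v) (case_sum (\<lambda>(u, v). Inr u) (\<lambda>v. Inl v))"
  define dv where "dv h x = (\<Sum>e\<in>UNIV. h e * (of_bool (tl e = x) - of_bool (hd e = x)) :: real)" for h x
  have split_sum: "(\<Sum>e\<in>UNIV. k e) = (\<Sum>u\<in>UNIV. \<Sum>v\<in>UNIV. k (Inl (u, v)))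
      + ((\<Sum>u\<in>UNIV. \<Sum>v\<in>UNIV. k (Inr (Inl (u, v)))) + (\<Sum>v\<in>UNIV. k (Inr (Inr v))))"
    for k :: "('v \<times> 'v) + ('v \<times> 'v) + 'v \<Rightarrow> real"
    by (simp add: UNIV_Plus_UNIV[symmetric] sum.Plus UNIV_Times_UNIV[symmetric] sum.cartesian_product
      del: UNIV_Plus_UNIV UNIV_Times_UNIV)
  have pick: "(\<Sum>u\<in>UNIV. \<Sum>v\<in>UNIV. k u v * (of_bool (u = x) - of_bool (v = x))) = netout k x"
    for k :: "'v \<Rightarrow> 'v \<Rightarrow> real" and x
    using sum_netout_mult[of k "\<lambda>u. of_bool (u = x)"] by (simp add: of_bool_def sum.delta if_distrib cong: if_cong)
  have dv_Inl: "dv h (Inl x) = netout (\<lambda>u v. h (Inl (u, v))) x - h (Inr (Inr x))" for h x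
    unfolding dv_def split_sum pick[symmetric]
    by (simp add: tl_def hd_def of_bool_def sum_negf if_distrib cong: if_cong)
  have pick': "(\<Sum>u\<in>UNIV. \<Sum>v\<in>UNIV. k u v * (of_bool (v = x) - of_bool (u = x))) = - netout k x"
    for k :: "'v \<Rightarrow> 'v \<Rightarrow> real" and x
    unfolding pick[symmetric] sum_negf[symmetric] mult_minus_right[symmetric] minus_diff_eq ..
  have dv_Inr: "dv h (Inr x) = h (Inr (Inr x)) - netout (\<lambda>u v. h (Inr (Inl (u, v)))) x" for h x
    unfolding dv_def split_sum by (simp add: tl_def hd_def pick')
  \<comment> \<open>The arcs joining the two copies of a node carry the common net outflow of
    \<open>f\<close> and \<open>g\<close>, which makes \<open>h\<close> a circulation.\<close>
  define h where "h = case_sum (\<lambda>(u, v). f u v) (case_sum (\<lambda>(u, v). g u v) (netout f))"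
  have "dv h x = 0" for x
    by (cases x) (simp_all add: dv_Inl dv_Inr h_def assms)
  then obtain k where k: "\<And>e. rounding (h e) (k e)" "\<And>x. dv k x = 0"
    using flow_rounding[of UNIV h tl hd] unfolding dv_def rounding_def by auto
  have Inl: "netout (\<lambda>u v. k (Inl (u, v))) x = k (Inr (Inr x))" for x
    using k(2)[of "Inl x"] by (simp add: dv_Inl)
  have Inr: "netout (\<lambda>u v. k (Inr (Inl (u, v)))) x = k (Inr (Inr x))" for x
    using k(2)[of "Inr x"] by (simp add: dv_Inr)
  show ?thesis
  proof (rule that[of "\<lambda>u v. k (Inl (u, v))" "\<lambda>u v. k (Inr (Inl (u, v)))"])
    show "rounding (f u v) (k (Inl (u, v)))" for u v
      using k(1)[of "Inl (u, v)"] by (simp add: h_def)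
    show "rounding (g u v) (k (Inr (Inl (u, v))))" for u v
      using k(1)[of "Inr (Inl (u, v))"] by (simp add: h_def)
    show "netout (\<lambda>u v. k (Inl (u, v))) = netout (\<lambda>u v. k (Inr (Inl (u, v))))"
      by (simp add: fun_eq_iff Inl Inr)
    show "rounding (netout f v) (netout (\<lambda>u v. k (Inl (u, v))) v)" for v
      using k(1)[of "Inr (Inr v)"] by (simp add: h_def Inl)
  qed
qed

section \<open>Normal cones described by tight flows\<close>

definition tight_flow ::
    "('n option \<times> 'n option) set \<Rightarrow> ('n option \<Rightarrow> 'n option \<Rightarrow> real) \<Rightarrow> real^'n
      \<Rightarrow> ('n option \<Rightarrow> 'n option \<Rightarrow> real) \<Rightarrow> bool" where
  "tight_flow E \<gamma> x f \<longleftrightarrow> (\<forall>u v. 0 \<le> f u v \<and>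
     (f u v \<noteq> 0 \<longrightarrow> (u, v) \<in> E \<and> append_zero x $ u - append_zero x $ v = \<gamma> u v))"

text \<open>The integer 0 is kept by rounding, so no new arcs enter the support, and it remains a
  lower bound.\<close>

lemma tight_flow_rounding:
  assumes "tight_flow E \<gamma> x f" "\<And>u v. rounding (f u v) (f' u v)"
  shows "tight_flow E \<gamma> x f'"
  unfolding tight_flow_def
proof (intro allI conjI impI)
  fix u v
  have f: "0 \<le> f u v" "f u v \<noteq> 0 \<Longrightarrow> (u, v) \<in> E \<and> append_zero x $ u - append_zero x $ v = \<gamma> u v"
    using assms(1) by (auto simp: tight_flow_def)
  show "0 \<le> f' u v"
    using rounding_ge[OF assms(2), of 0 u v] f(1) by simp
  assume "f' u v \<noteq> 0"
  then have "f u v \<noteq> 0"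
    using rounding_eq[OF assms(2), of u v] by auto
  then show "(u, v) \<in> E" "append_zero x $ u - append_zero x $ v = \<gamma> u v"
    using f(2) by auto
qed

text \<open>Tight flows are the Farkas multipliers of normal vectors: nonnegative weights on the
  bounds attained with equality. For \<open>x1\<close> and \<open>x2\<close> in the two polyhedra,
  this set is the intersection of the normal cones at these points, that is, the normal cone of the
  Minkowski sum at \<open>x1 + x2\<close>.\<close>

definition flow_cone ::
    "('n option \<times> 'n option) set \<Rightarrow> ('n option \<Rightarrow> 'n option \<Rightarrow> real) \<Rightarrow> real^'n
     \<Rightarrow> ('n option \<times> 'n option) set \<Rightarrow> ('n option \<Rightarrow> 'n option \<Rightarrow> real) \<Rightarrow> real^'n
     \<Rightarrow> (real^'n) set" where
  "flow_cone E1 \<gamma>1 x1 E2 \<gamma>2 x2 = {p. \<exists>f g. tight_flow E1 \<gamma>1 x1 f \<and> tight_flow E2 \<gamma>2 x2 g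
     \<and> netout f = netout g \<and> p = (\<chi> j. netout f (Some j))}"

lemma netout_pairing:
  fixes x :: "real^'n"
  shows "(\<chi> j. netout f (Some j)) \<bullet> x
    = (\<Sum>u\<in>UNIV. \<Sum>v\<in>UNIV. f u v * (append_zero x $ u - append_zero x $ v))"
  unfolding sum_netout_mult[symmetric]
  by (simp add: UNIV_option_conv sum.reindex inner_vec_def)

lemma tight_flow_optimal:
  assumes "tight_flow E \<gamma> x f" "y \<in> potential_polyhedron E \<gamma>"
  shows "(\<chi> j. netout f (Some j)) \<bullet> y \<le> (\<chi> j. netout f (Some j)) \<bullet> x"
  unfolding netout_pairing
proof (intro sum_mono)
  fix u v
  show "f u v * (append_zero y $ u - append_zero y $ v) \<le> f u v * (append_zero x $ u - append_zero x $ v)"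
    using assms by (cases "f u v = 0")
      (auto simp: tight_flow_def potential_polyhedron_def intro!: mult_left_mono)
qed

lemma flow_cone_optimal:
  assumes "p \<in> flow_cone E1 \<gamma>1 x1 E2 \<gamma>2 x2"
    and "y1 \<in> potential_polyhedron E1 \<gamma>1" "y2 \<in> potential_polyhedron E2 \<gamma>2"
  shows "p \<bullet> (y1 + y2) \<le> p \<bullet> (x1 + x2)"
proof -
  obtain f g where fg: "tight_flow E1 \<gamma>1 x1 f" "tight_flow E2 \<gamma>2 x2 g" "netout f = netout g"
    "p = (\<chi> j. netout f (Some j))"
    using assms(1) by (auto simp: flow_cone_def)
  have "p \<bullet> y1 \<le> p \<bullet> x1"
    unfolding fg(4) by (rule tight_flow_optimal[OF fg(1) assms(2)])
  moreover have "p \<bullet> y2 \<le> p \<bullet> x2"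
    unfolding fg(4) fg(3) by (rule tight_flow_optimal[OF fg(2) assms(3)])
  ultimately show ?thesis by (simp add: inner_add_right)
qed

lemma flow_cone_rounding:
  assumes "p \<in> flow_cone E1 \<gamma>1 x1 E2 \<gamma>2 x2"
  obtains p' where "p' \<in> flow_cone E1 \<gamma>1 x1 E2 \<gamma>2 x2" "\<And>j. rounding (p $ j) (p' $ j)"
proof -
  obtain f g where fg: "tight_flow E1 \<gamma>1 x1 f" "tight_flow E2 \<gamma>2 x2 g" "netout f = netout g"
    "p = (\<chi> j. netout f (Some j))"
    using assms by (auto simp: flow_cone_def)
  from common_netout_rounding[OF fg(3)] obtain f' g' where
    fg': "\<And>u v. rounding (f u v) (f' u v)" "\<And>u v. rounding (g u v) (g' u v)"
    "netout f' = netout g'" "\<And>v. rounding (netout f v) (netout f' v)" by blast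
  have "tight_flow E1 \<gamma>1 x1 f'" "tight_flow E2 \<gamma>2 x2 g'"
    using tight_flow_rounding fg fg' by blast+
  then have "(\<chi> j. netout f' (Some j)) \<in> flow_cone E1 \<gamma>1 x1 E2 \<gamma>2 x2"
    using fg'(3) unfolding flow_cone_def by blast
  then show ?thesis
    by (rule that) (simp add: fg(4) fg'(4))
qed

lemma tight_flow_mult: "tight_flow E \<gamma> x f \<Longrightarrow> 0 \<le> c \<Longrightarrow> tight_flow E \<gamma> x (\<lambda>u v. c * f u v)"
  by (auto simp: tight_flow_def)

lemma flow_cone_scaleR:
  assumes "p \<in> flow_cone E1 \<gamma>1 x1 E2 \<gamma>2 x2" "0 \<le> c"
  shows "c *\<^sub>R p \<in> flow_cone E1 \<gamma>1 x1 E2 \<gamma>2 x2"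
proof -
  obtain f g where fg: "tight_flow E1 \<gamma>1 x1 f" "tight_flow E2 \<gamma>2 x2 g" "netout f = netout g"
    "p = (\<chi> j. netout f (Some j))"
    using assms by (auto simp: flow_cone_def)
  have "netout (\<lambda>u v. c * f u v) = netout (\<lambda>u v. c * g u v)"
    using fg(3) by (simp add: fun_eq_iff netout_mult)
  then show ?thesis
    unfolding flow_cone_def using fg assms(2)
    by (intro CollectI exI[of _ "\<lambda>u v. c * f u v"] exI[of _ "\<lambda>u v. c * g u v"])
      (auto simp: netout_mult vec_eq_iff tight_flow_mult)
qed

text \<open>Linear programming duality for pairs \<open>(y1, y2)\<close>. The objective
  \<open>(q, q)\<close> and the box rows treat both components alike, so each component of the dual
  equation reads \<open>q\<close> = net outflow + \<open>r\<close> with the same box part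
  \<open>r\<close>, and the two net outflows agree. By complementary slackness, the sign of
  \<open>r j\<close> indicates an active box bound.\<close>

lemma flow_cone_normal:
  fixes x1 x2 q d c :: "real^'n"
  assumes x: "x1 \<in> potential_polyhedron E1 \<gamma>1" "x2 \<in> potential_polyhedron E2 \<gamma>2" "x1 + x2 \<in> cbox d c"
    and opt: "\<And>y1 y2. y1 \<in> potential_polyhedron E1 \<gamma>1 \<Longrightarrow> y2 \<in> potential_polyhedron E2 \<gamma>2
      \<Longrightarrow> y1 + y2 \<in> cbox d c \<Longrightarrow> q \<bullet> (y1 + y2) \<le> q \<bullet> (x1 + x2)"
  obtains p where "p \<in> flow_cone E1 \<gamma>1 x1 E2 \<gamma>2 x2"
    "\<And>j. p $ j < q $ j \<Longrightarrow> (x1 + x2) $ j = c $ j" "\<And>j. q $ j < p $ j \<Longrightarrow> (x1 + x2) $ j = d $ j"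
proof -
  \<comment> \<open>The value 0 at \<open>None\<close> encodes the fixed potential 0 of the
    additional node.\<close>
  define \<delta> :: "'n option \<Rightarrow> real^'n" where "\<delta> = case_option 0 (\<lambda>j. axis j 1)"
  have \<delta>: "\<delta> v \<bullet> z = append_zero z $ v" for v z
    by (cases v) (simp_all add: \<delta>_def inner_axis')
  define I :: "(('n option \<times> 'n option) + ('n option \<times> 'n option) + 'n + 'n) set"
    where "I = E1 <+> E2 <+> UNIV <+> UNIV"
  define a :: "('n option \<times> 'n option) + ('n option \<times> 'n option) + 'n + 'n \<Rightarrow> (real^'n) \<times> (real^'n)"
    where "a = case_sum (\<lambda>(u, v). (\<delta> u - \<delta> v, 0)) (case_sum (\<lambda>(u, v). (0, \<delta> u - \<delta> v))
      (case_sum (\<lambda>j. (axis j 1, axis j 1)) (\<lambda>j. (- axis j 1, - axis j 1))))"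
  define b where "b = case_sum (\<lambda>(u, v). \<gamma>1 u v) (case_sum (\<lambda>(u, v). \<gamma>2 u v)
      (case_sum (\<lambda>j. c $ j) (\<lambda>j. - d $ j)))"
  have "finite I" by (simp add: I_def)
  have sol: "(\<forall>i\<in>I. a i \<bullet> (y1, y2) \<le> b i) \<longleftrightarrow> y1 \<in> potential_polyhedron E1 \<gamma>1
      \<and> y2 \<in> potential_polyhedron E2 \<gamma>2 \<and> y1 + y2 \<in> cbox d c" for y1 y2
    by (auto simp: I_def a_def b_def Plus_def ball_Un potential_polyhedron_def mem_box_cart
        inner_diff_left \<delta> inner_axis' algebra_simps split_beta)
  obtain y where y: "\<And>i. i \<in> I \<Longrightarrow> 0 \<le> y i" "\<And>i. i \<in> I \<Longrightarrow> a i \<bullet> (x1, x2) < b i \<Longrightarrow> y i = 0"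
    "(\<Sum>i\<in>I. y i *\<^sub>R a i) = (q, q)"
  proof (rule complementary_slackness[OF \<open>finite I\<close>, of a "(x1, x2)" b "(q, q)"])
    show "a i \<bullet> (x1, x2) \<le> b i" if "i \<in> I" for i
      using sol[of x1 x2] x that by blast
    fix v assume "\<And>i. i \<in> I \<Longrightarrow> a i \<bullet> v \<le> b i"
    then show "(q, q) \<bullet> v \<le> (q, q) \<bullet> (x1, x2)"
      using sol[of "fst v" "snd v"] opt[of "fst v" "snd v"] by (cases v) (simp add: inner_add_right)
  qed blast
  define f where "f u v = (if (u, v) \<in> E1 then y (Inl (u, v)) else 0)" for u v
  define g where "g u v = (if (u, v) \<in> E2 then y (Inr (Inl (u, v))) else 0)" for u v
  define r where "r j = y (Inr (Inr (Inl j))) - y (Inr (Inr (Inr j)))" for j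
  have netout_eq: "netout h (Some j) = (\<Sum>(u, v)\<in>E. y' (u, v) * (\<delta> u - \<delta> v) $ j)"
    if "\<And>u v. h u v = (if (u, v) \<in> E then y' (u, v) else 0)" for h y' j and E :: "('n option \<times> 'n option) set"
  proof -
    have \<delta>_nth: "\<delta> u $ j = of_bool (u = Some j)" for u
      by (cases u) (auto simp: \<delta>_def axis_def)
    have "netout h (Some j) = (\<Sum>u\<in>UNIV. netout h u * \<delta> u $ j)"
      by (simp add: \<delta>_nth)
    also have "\<dots> = (\<Sum>(u, v)\<in>UNIV. h u v * (\<delta> u - \<delta> v) $ j)"
      by (simp add: sum_netout_mult sum.cartesian_product)
    also have "\<dots> = (\<Sum>(u, v)\<in>E. y' (u, v) * (\<delta> u - \<delta> v) $ j)"
      by (intro sum.mono_neutral_cong_right) (auto simp: that)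
    finally show ?thesis .
  qed
  have box_part: "(\<Sum>k\<in>UNIV. z k * axis k (1::real) $ j) = z j" for z j
    by (simp add: axis_def if_distrib cong: if_cong)
  have split_sum: "(\<Sum>i\<in>I. y i *\<^sub>R a i)
    = (\<Sum>e\<in>E1. y (Inl e) *\<^sub>R a (Inl e)) + ((\<Sum>e\<in>E2. y (Inr (Inl e)) *\<^sub>R a (Inr (Inl e)))
      + ((\<Sum>j\<in>UNIV. y (Inr (Inr (Inl j))) *\<^sub>R a (Inr (Inr (Inl j))))
        + (\<Sum>j\<in>UNIV. y (Inr (Inr (Inr j))) *\<^sub>R a (Inr (Inr (Inr j))))))"
    unfolding I_def by (simp add: sum.Plus del: UNIV_Plus_UNIV)
  have f_eq: "q $ j = netout f (Some j) + r j" for j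
  proof -
    have "q $ j = fst (\<Sum>i\<in>I. y i *\<^sub>R a i) $ j" by (simp add: y(3))
    then show ?thesis
      unfolding split_sum netout_eq[of f E1 "\<lambda>e. y (Inl e)", OF f_def]
      by (simp add: a_def fst_sum split_beta sum_negf box_part r_def)
  qed
  have g_eq: "q $ j = netout g (Some j) + r j" for j
  proof -
    have "q $ j = snd (\<Sum>i\<in>I. y i *\<^sub>R a i) $ j" by (simp add: y(3))
    then show ?thesis
      unfolding split_sum netout_eq[of g E2 "\<lambda>e. y (Inr (Inl e))", OF g_def]
      by (simp add: a_def snd_sum split_beta sum_negf box_part r_def)
  qed
  have eq: "netout f = netout g"
  proof
    fix v
    have "netout f (Some j) = netout g (Some j)" for j
      using f_eq[of j] g_eq[of j] by simp
    then show "netout f v = netout g v"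
      by (cases v) (simp_all add: netout_None)
  qed
  have "tight_flow E1 \<gamma>1 x1 f"
    using x(1) y(1)[of "Inl _"] y(2)[of "Inl _"]
    by (force simp: tight_flow_def f_def I_def a_def b_def inner_diff_left \<delta> potential_polyhedron_def)
  moreover have "tight_flow E2 \<gamma>2 x2 g"
    using x(2) y(1)[of "Inr (Inl _)"] y(2)[of "Inr (Inl _)"]
    by (force simp: tight_flow_def g_def I_def a_def b_def inner_diff_left \<delta> potential_polyhedron_def)
  ultimately have p: "(\<chi> j. netout f (Some j)) \<in> flow_cone E1 \<gamma>1 x1 E2 \<gamma>2 x2"
    using eq unfolding flow_cone_def by blast
  show ?thesis
  proof (rule that[OF p])
    have x_box: "d $ j \<le> (x1 + x2) $ j" "(x1 + x2) $ j \<le> c $ j" for j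
      using x(3) by (auto simp: mem_box_cart)
    show "(x1 + x2) $ j = c $ j" if "(\<chi> j. netout f (Some j)) $ j < q $ j" for j
    proof (rule ccontr)
      assume "(x1 + x2) $ j \<noteq> c $ j"
      then have "y (Inr (Inr (Inl j))) = 0"
        using x_box[of j] by (intro y(2)) (auto simp: I_def a_def b_def inner_axis')
      then show False
        using that f_eq[of j] y(1)[of "Inr (Inr (Inr j))"] by (auto simp: r_def I_def)
    qed
    show "(x1 + x2) $ j = d $ j" if "q $ j < (\<chi> j. netout f (Some j)) $ j" for j
    proof (rule ccontr)
      assume "(x1 + x2) $ j \<noteq> d $ j"
      then have "y (Inr (Inr (Inr j))) = 0"
        using x_box[of j] by (intro y(2)) (auto simp: I_def a_def b_def inner_axis')
      then show False
        using that f_eq[of j] y(1)[of "Inr (Inr (Inl j))"] by (auto simp: r_def I_def)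
    qed
  qed
qed

section \<open>Integral decomposition into vectors with entries -1, 0 and 1\<close>

definition ternary_vectors :: "(real^'n) set" where
  "ternary_vectors = {w. \<forall>j. w $ j \<in> {-1, 0, 1}}"

lemma finite_ternary_vectors: "finite (ternary_vectors :: (real^'n) set)"
proof -
  have "(ternary_vectors :: (real^'n) set) \<subseteq> vec_lambda ` (UNIV \<rightarrow>\<^sub>E {-1, 0, 1})"
  proof
    fix w :: "real^'n" assume "w \<in> ternary_vectors"
    then show "w \<in> vec_lambda ` (UNIV \<rightarrow>\<^sub>E {-1, 0, 1})"
      by (intro image_eqI[of _ _ "vec_nth w"]) (auto simp: ternary_vectors_def PiE_def)
  qed
  then show ?thesis by (rule finite_subset) (simp add: finite_PiE)
qed

text \<open>Induction on the sum of the absolute net outflows of a pair of integral flows. Rounding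
  both flows divided by \<open>M\<close> splits off a vector of the cone, and the remainder is again
  a pair of tight integral flows with common net outflow and a smaller sum.\<close>

lemma flow_cone_integer_decomposition:
  fixes p :: "real^'n"
  assumes "p \<in> flow_cone E1 \<gamma>1 x1 E2 \<gamma>2 x2" and "\<And>j. p $ j \<in> \<int>"
  obtains k :: "real^'n \<Rightarrow> nat" where "p = (\<Sum>w\<in>ternary_vectors. real (k w) *\<^sub>R w)"
    "\<And>w. k w \<noteq> 0 \<Longrightarrow> w \<in> flow_cone E1 \<gamma>1 x1 E2 \<gamma>2 x2"
proof -
  have main: "\<exists>k :: real^'n \<Rightarrow> nat. (\<chi> j. netout f (Some j)) = (\<Sum>w\<in>ternary_vectors. real (k w) *\<^sub>R w)
      \<and> (\<forall>w. k w \<noteq> 0 \<longrightarrow> w \<in> flow_cone E1 \<gamma>1 x1 E2 \<gamma>2 x2)"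
    if "tight_flow E1 \<gamma>1 x1 f" "tight_flow E2 \<gamma>2 x2 g" "netout f = netout g"
      "\<And>u v. f u v \<in> \<int>" "\<And>u v. g u v \<in> \<int>" for f g
    using that
  proof (induction "nat \<lfloor>\<Sum>v\<in>UNIV. \<bar>netout f v\<bar>\<rfloor>" arbitrary: f g rule: less_induct)
    case less
    have Ints: "netout f v \<in> \<int>" for v
      using less.prems(4) by (auto simp: netout_def intro!: Ints_diff Ints_sum)
    \<comment> \<open>The maximum ranges over \<open>None\<close> as well, like the sum that serves
      as induction measure.\<close>
    define M where "M = Max (range (\<lambda>v. \<bar>netout f v\<bar>))"
    have le_M: "\<bar>netout f v\<bar> \<le> M" for v by (auto simp: M_def)
    have "M \<in> range (\<lambda>v. \<bar>netout f v\<bar>)"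
      unfolding M_def by (rule Max_in) auto
    then obtain m where m: "M = \<bar>netout f m\<bar>" by blast
    show ?case
    proof (cases "M = 0")
      case True
      then have "(\<chi> j. netout f (Some j)) = 0" using le_M by (simp add: vec_eq_iff)
      then show ?thesis by (intro exI[of _ "\<lambda>_. 0"]) simp
    next
      case False
      have "1 \<le> M" using False m Ints[of m] Ints_nonzero_abs_ge1[of "netout f m"] by auto
      have div_le: "t / M \<le> t" if "0 \<le> t" for t
        using \<open>1 \<le> M\<close> that by (simp add: divide_le_eq mult_left_le_one_le mult_le_cancel_left1)
      have eqM: "netout (\<lambda>u v. (1 / M) * f u v) = netout (\<lambda>u v. (1 / M) * g u v)"
        by (rule ext) (simp only: netout_mult less.prems(3))
      obtain f1 g1 where fg1: "\<And>u v. rounding (1 / M * f u v) (f1 u v)"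
        "\<And>u v. rounding (1 / M * g u v) (g1 u v)" "netout f1 = netout g1"
        "\<And>v. rounding (1 / M * netout f v) (netout f1 v)"
        using common_netout_rounding[OF eqM] unfolding netout_mult by blast
      have tight1: "tight_flow E1 \<gamma>1 x1 f1" "tight_flow E2 \<gamma>2 x2 g1"
        using tight_flow_rounding[OF tight_flow_mult[OF less.prems(1)] fg1(1)]
          tight_flow_rounding[OF tight_flow_mult[OF less.prems(2)] fg1(2)] \<open>1 \<le> M\<close> by auto
      have Ints1: "f1 u v \<in> \<int>" "g1 u v \<in> \<int>" "netout f1 v \<in> \<int>" for u v
        using fg1 by (auto simp: rounding_def)
      \<comment> \<open>As \<open>h\<close> is integral and nonnegative and \<open>M\<close> is at
        least 1, \<open>h\<close> is an integer upper bound of \<open>h / M\<close> and hence of its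
        rounding \<open>h1\<close>.\<close>
      have diff: "tight_flow E \<gamma> x (\<lambda>u v. h u v - h1 u v)"
        if h: "tight_flow E \<gamma> x h" "\<And>u v. h u v \<in> \<int>" "\<And>u v. rounding (1 / M * h u v) (h1 u v)"
        for E \<gamma> x h h1
        unfolding tight_flow_def
      proof (intro allI conjI impI)
        fix u v
        have "0 \<le> h u v" using h(1) by (simp add: tight_flow_def)
        then show "0 \<le> h u v - h1 u v"
          using h(2) div_le[of "h u v"] rounding_le[OF h(3), of "h u v" u v] by simp
        assume "h u v - h1 u v \<noteq> 0"
        then have "h u v \<noteq> 0" using rounding_eq[OF h(3), of u v] by auto
        then show "(u, v) \<in> E" "append_zero x $ u - append_zero x $ v = \<gamma> u v"
          using h(1) by (auto simp: tight_flow_def)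
      qed
      define w where "w = (\<chi> j. netout f1 (Some j))"
      have w_cone: "w \<in> flow_cone E1 \<gamma>1 x1 E2 \<gamma>2 x2"
        unfolding flow_cone_def w_def using tight1 fg1(3) by blast
      have ternary: "netout f1 v \<in> {-1, 0, 1}" for v
      proof -
        have "- 1 \<le> 1 / M * netout f v" "1 / M * netout f v \<le> 1"
          using le_M[of v] \<open>1 \<le> M\<close> by (auto simp: divide_le_eq le_divide_eq abs_le_iff)
        from rounding_ge[OF fg1(4) _ this(1)] rounding_le[OF fg1(4) _ this(2)]
        have "- 1 \<le> netout f1 v" "netout f1 v \<le> 1" by auto
        then show ?thesis using Ints1(3)[of v] by (auto simp: Ints_def) 
      qed
      \<comment> \<open>The rounded net outflow lies between 0 and the net outflow of
        \<open>f\<close>, so subtracting it cannot overshoot.\<close>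
      have abs_diff: "\<bar>netout f v - netout f1 v\<bar> \<le> \<bar>netout f v\<bar> - \<bar>netout f1 v\<bar>" for v
      proof (cases "0 \<le> netout f v")
        case True
        then have "0 \<le> 1 / M * netout f v" "1 / M * netout f v \<le> netout f v"
          using \<open>1 \<le> M\<close> div_le[of "netout f v"] by auto
        from rounding_ge[OF fg1(4) _ this(1)] rounding_le[OF fg1(4) Ints this(2)]
        have "0 \<le> netout f1 v" "netout f1 v \<le> netout f v" by auto
        then show ?thesis by simp
      next
        case False
        then have "1 / M * netout f v \<le> 0" "netout f v \<le> 1 / M * netout f v"
          using \<open>1 \<le> M\<close> div_le[of "- netout f v"] by (auto simp: divide_nonpos_pos)
        from rounding_le[OF fg1(4) _ this(1)] rounding_ge[OF fg1(4) Ints this(2)]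
        have "netout f1 v \<le> 0" "netout f v \<le> netout f1 v" by auto
        then show ?thesis by simp
      qed
      \<comment> \<open>At \<open>m\<close> the quotient is 1 or -1, which rounding keeps; this
        makes the decrease strict.\<close>
      have "netout f m = M \<or> netout f m = - M" using m by linarith
      then have "netout f1 m = 1 \<or> netout f1 m = - 1"
        using rounding_eq[OF fg1(4), of m] False by auto
      then have "\<bar>netout f m - netout f1 m\<bar> < \<bar>netout f m\<bar>"
        using abs_diff[of m] by auto
      moreover have "\<bar>netout f v - netout f1 v\<bar> \<le> \<bar>netout f v\<bar>" for v
        using abs_diff[of v] by auto
      ultimately have less_sum: "(\<Sum>v\<in>UNIV. \<bar>netout f v - netout f1 v\<bar>) < (\<Sum>v\<in>UNIV. \<bar>netout f v\<bar>)"
        by (intro sum_strict_mono_ex1) auto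
      have floor_less: "nat \<lfloor>a\<rfloor> < nat \<lfloor>b\<rfloor>" if "a \<in> \<int>" "b \<in> \<int>" "0 \<le> a" "a < b" for a b :: real
        using that by (auto elim!: Ints_cases)
      have "nat \<lfloor>\<Sum>v\<in>UNIV. \<bar>netout (\<lambda>u v. f u v - f1 u v) v\<bar>\<rfloor> < nat \<lfloor>\<Sum>v\<in>UNIV. \<bar>netout f v\<bar>\<rfloor>"
        unfolding netout_diff using less_sum Ints Ints1(3)
        by (intro floor_less) (auto intro!: Ints_sum Ints_abs Ints_diff sum_nonneg)
      then have "\<exists>k :: real^'n \<Rightarrow> nat. (\<chi> j. netout (\<lambda>u v. f u v - f1 u v) (Some j)) = (\<Sum>w\<in>ternary_vectors. real (k w) *\<^sub>R w)
        \<and> (\<forall>w. k w \<noteq> 0 \<longrightarrow> w \<in> flow_cone E1 \<gamma>1 x1 E2 \<gamma>2 x2)"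
        using less.prems fg1(3) Ints1
        by (intro less.hyps[of _ "\<lambda>u v. g u v - g1 u v"] diff[OF _ _ fg1(1)] diff[OF _ _ fg1(2)])
          (auto simp: netout_diff fun_eq_iff)
      then obtain k :: "real^'n \<Rightarrow> nat" where
        k: "(\<chi> j. netout (\<lambda>u v. f u v - f1 u v) (Some j)) = (\<Sum>w\<in>ternary_vectors. real (k w) *\<^sub>R w)"
        "\<forall>w. k w \<noteq> 0 \<longrightarrow> w \<in> flow_cone E1 \<gamma>1 x1 E2 \<gamma>2 x2" by blast
      have "w \<in> ternary_vectors" using ternary by (simp add: w_def ternary_vectors_def)
      then have "(\<Sum>w'\<in>ternary_vectors. real ((k(w := Suc (k w))) w') *\<^sub>R w')
        = (\<Sum>w'\<in>ternary_vectors. real (k w') *\<^sub>R w') + w"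
        by (simp add: sum.remove[OF finite_ternary_vectors, of w] scaleR_left_distrib)
      also have "\<dots> = (\<chi> j. netout f (Some j))"
        by (simp add: k(1)[symmetric] w_def vec_eq_iff netout_diff)
      finally show ?thesis
        using k(2) w_cone by (intro exI[of _ "k(w := Suc (k w))"]) auto
    qed
  qed
  obtain f g where fg: "tight_flow E1 \<gamma>1 x1 f" "tight_flow E2 \<gamma>2 x2 g" "netout f = netout g"
    "p = (\<chi> j. netout f (Some j))"
    using assms(1) by (auto simp: flow_cone_def)
  \<comment> \<open>A first rounding makes the flows integral; it leaves \<open>p\<close> unchanged
    because the entries of \<open>p\<close> are integers.\<close>
  obtain f1 g1 where
    fg1: "\<And>u v. rounding (f u v) (f1 u v)" "\<And>u v. rounding (g u v) (g1 u v)"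
    "netout f1 = netout g1" "\<And>v. rounding (netout f v) (netout f1 v)"
    using common_netout_rounding[OF fg(3)] by blast
  have "p = (\<chi> j. netout f1 (Some j))"
    using rounding_eq[OF fg1(4)] assms(2) by (simp add: fg(4) vec_eq_iff)
  moreover have "f1 u v \<in> \<int>" "g1 u v \<in> \<int>" for u v
    using fg1 by (auto simp: rounding_def)
  ultimately show ?thesis
    using main[of f1 g1] tight_flow_rounding[OF fg(1) fg1(1)] tight_flow_rounding[OF fg(2) fg1(2)] fg1(3) that
    by metis
qed

section \<open>Box-total dual integrality\<close>

lemma weak_duality:
  assumes "x \<in> solutions I A b" "dual_feasible I A c y"
  shows "c \<bullet> x \<le> dual_value I b y"
proof -
  have "c \<bullet> x = (\<Sum>i\<in>I. y i * (A i \<bullet> x))"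
    using assms(2) by (auto simp: dual_feasible_def inner_sum_left)
  also have "\<dots> \<le> dual_value I b y"
    unfolding dual_value_def using assms
    by (intro sum_mono mult_left_mono) (auto simp: dual_feasible_def solutions_def)
  finally show ?thesis .
qed

text \<open>Adding a large multiple of the ray to a feasible solution pushes the dual value below
  any bound. Exhibiting such rays is how a finite dual minimum is shown to force primal
  feasibility.\<close>

lemma dual_ray_unbounded:
  assumes ray: "dual_feasible I A 0 r" "dual_value I b r < 0"
  shows "\<not> dual_min_finite I A b c"
proof
  assume "dual_min_finite I A b c"
  then obtain y B where y: "dual_feasible I A c y"
    and B: "\<And>z. dual_feasible I A c z \<Longrightarrow> B \<le> dual_value I b z"
    by (auto simp: dual_min_finite_def bdd_below_def)
  define t where "t = max 0 ((B - 1 - dual_value I b y) / dual_value I b r)"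
  have "dual_feasible I A c (\<lambda>i. y i + t * r i)"
    using y ray(1) scaleR_sum_right[of t "\<lambda>i. r i *\<^sub>R A i" I]
    by (auto simp: dual_feasible_def t_def scaleR_left_distrib sum.distrib)
  then have "B \<le> dual_value I b y + t * dual_value I b r"
    using B[of "\<lambda>i. y i + t * r i"]
    by (simp add: dual_value_def sum_distrib_left algebra_simps sum.distrib)
  also have "t * dual_value I b r \<le> B - 1 - dual_value I b y"
  proof -
    have "(B - 1 - dual_value I b y) / dual_value I b r \<le> t" by (simp add: t_def)
    then have "t * dual_value I b r \<le> (B - 1 - dual_value I b y) / dual_value I b r * dual_value I b r"
      using ray(2) by (intro mult_right_mono_neg) auto
    then show ?thesis using ray(2) by simp
  qed
  finally show False by simp
qed

text \<open>Multipliers of a boxed system: \<open>k\<close> for its own rows, \<open>s\<close> for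
  the upper and \<open>t\<close> for the lower bounds.\<close>

definition box_dual :: "('i \<Rightarrow> real) \<Rightarrow> real^'n \<Rightarrow> real^'n \<Rightarrow> 'i + 'n + 'n \<Rightarrow> real" where
  "box_dual k s t = case_sum k (case_sum (($) s) (($) t))"

lemma sum_box_index:
  fixes F :: "'i + 'n::finite + 'n \<Rightarrow> 'a::comm_monoid_add"
  assumes "finite I"
  shows "(\<Sum>i\<in>box_index I. F i)
    = (\<Sum>i\<in>I. F (Inl i)) + ((\<Sum>j\<in>UNIV. F (Inr (Inl j))) + (\<Sum>j\<in>UNIV. F (Inr (Inr j))))"
  using assms unfolding box_index_def by (simp add: sum.Plus del: UNIV_Plus_UNIV)

lemma dual_feasible_box_dual:
  assumes "finite I" "\<And>i. i \<in> I \<Longrightarrow> 0 \<le> k i" "\<And>j. 0 \<le> s $ j" "\<And>j. 0 \<le> t $ j"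
    and "(\<Sum>i\<in>I. k i *\<^sub>R A i) + s - t = q"
  shows "dual_feasible (box_index I) (box_rows A) q (box_dual k s t)"
proof -
  have axis_sum: "(\<Sum>j\<in>UNIV. s $ j *\<^sub>R axis j 1) = s" for s :: "real^'n"
    by (simp add: vec_eq_iff axis_def if_distrib cong: if_cong)
  show ?thesis
    unfolding dual_feasible_def
  proof (intro conjI ballI)
    show "0 \<le> box_dual k s t i" if "i \<in> box_index I" for i
      using that assms(2-4) by (auto simp: box_index_def box_dual_def split: sum.split)
    show "(\<Sum>i\<in>box_index I. box_dual k s t i *\<^sub>R box_rows A i) = q"
      using assms(1,5) by (simp add: sum_box_index box_rows_def box_dual_def sum_negf axis_sum add_diff_eq)
  qed
qed

lemma rational_system_box:
  assumes "rational_system I A b" "\<forall>j. d $ j \<in> \<rat>" "\<forall>j. c $ j \<in> \<rat>"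
  shows "rational_system (box_index I) (box_rows A) (box_rhs b d c)"
  using assms
  by (auto simp: rational_system_def box_index_def box_rows_def box_rhs_def axis_def split: sum.split)

lemma dual_value_box_dual:
  assumes "finite I"
  shows "dual_value (box_index I) (box_rhs b d c) (box_dual k s t)
    = (\<Sum>i\<in>I. k i * b i) + s \<bullet> c - t \<bullet> d"
  using assms
  by (simp add: dual_value_def sum_box_index box_rhs_def box_dual_def inner_vec_def sum_negf)

section \<open>The defining system of the sum and its box-total dual integrality\<close>

locale potential_sum =
  fixes P :: "(real^'n) set" and E1 \<gamma>1 E2 \<gamma>2
  assumes P_eq: "P = {x + y |x y. x \<in> potential_polyhedron E1 \<gamma>1 \<and> y \<in> potential_polyhedron E2 \<gamma>2}"
    and closed: "closed P" and convex: "convex P" and nonempty: "P \<noteq> {}"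
begin

text \<open>These vectors are the rows of the system. Attainment makes \<open>support_value\<close>
  an actual optimum over \<open>P\<close>, and so rational when \<open>P\<close> is
  rational.\<close>

definition attaining :: "(real^'n) set" where
  "attaining = {w \<in> ternary_vectors. \<exists>x\<in>P. \<forall>y\<in>P. w \<bullet> y \<le> w \<bullet> x}"

definition support_value :: "real^'n \<Rightarrow> real" where
  "support_value w = (SUP y\<in>P. w \<bullet> y)"

lemma support_value_eq:
  assumes "x \<in> P" "\<And>y. y \<in> P \<Longrightarrow> w \<bullet> y \<le> w \<bullet> x"
  shows "support_value w = w \<bullet> x"
  unfolding support_value_def using assms by (intro cSup_eq_maximum) auto

text \<open>All vectors occurring in the decomposition attain their maximum over \<open>P\<close> at
  the same point \<open>x1 + x2\<close>, so their support values add up to the value of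
  \<open>p\<close> there.\<close>

lemma flow_cone_integral_combination:
  assumes x: "x1 \<in> potential_polyhedron E1 \<gamma>1" "x2 \<in> potential_polyhedron E2 \<gamma>2"
    and p: "p \<in> flow_cone E1 \<gamma>1 x1 E2 \<gamma>2 x2" "\<And>j. p $ j \<in> \<int>"
  obtains k :: "real^'n \<Rightarrow> nat" where "p = (\<Sum>w\<in>attaining. real (k w) *\<^sub>R w)"
    "(\<Sum>w\<in>attaining. real (k w) * support_value w) = p \<bullet> (x1 + x2)"
proof -
  obtain k :: "real^'n \<Rightarrow> nat" where k: "p = (\<Sum>w\<in>ternary_vectors. real (k w) *\<^sub>R w)"
    "\<And>w. k w \<noteq> 0 \<Longrightarrow> w \<in> flow_cone E1 \<gamma>1 x1 E2 \<gamma>2 x2"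
    using flow_cone_integer_decomposition[OF p] by blast
  have "x1 + x2 \<in> P" using x by (auto simp: P_eq)
  have opt: "w \<bullet> y \<le> w \<bullet> (x1 + x2)" if "k w \<noteq> 0" "y \<in> P" for w y
    using flow_cone_optimal[OF k(2)[OF that(1)]] that(2) by (auto simp: P_eq)
  have p_eq: "p = (\<Sum>w\<in>attaining. real (k w) *\<^sub>R w)"
    unfolding k(1) using opt \<open>x1 + x2 \<in> P\<close>
    by (intro sum.mono_neutral_right finite_ternary_vectors) (auto simp: attaining_def)
  have "real (k w) * support_value w = real (k w) * (w \<bullet> (x1 + x2))" for w
    using support_value_eq[OF \<open>x1 + x2 \<in> P\<close> opt] by (cases "k w = 0") auto
  then have "(\<Sum>w\<in>attaining. real (k w) * support_value w) = p \<bullet> (x1 + x2)"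
    unfolding p_eq inner_sum_left inner_scaleR_left by (intro sum.cong refl)
  with p_eq show ?thesis by (rule that)
qed

text \<open>The vector from \<open>P\<close> to the box between two nearest points is a normal vector of \<open>P\<close>; the rounding
  error of a large multiple of it is negligible on the box.\<close>

lemma separation_from_box:
  assumes "cbox d c \<noteq> {}" "P \<inter> cbox d c = {}"
  obtains x1 x2 p where "x1 \<in> potential_polyhedron E1 \<gamma>1" "x2 \<in> potential_polyhedron E2 \<gamma>2"
    "p \<in> flow_cone E1 \<gamma>1 x1 E2 \<gamma>2 x2" "\<And>j. p $ j \<in> \<int>"
    "\<And>z. z \<in> cbox d c \<Longrightarrow> p \<bullet> (x1 + x2) < p \<bullet> z"
proof -
  obtain z0 x where z0: "z0 \<in> cbox d c" and x: "x \<in> P" and dist: "dist z0 x = setdist (cbox d c) P"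
    using setdist_compact_closed[OF compact_cbox closed assms(1) nonempty] by blast
  define v where "v = z0 - x"
  have "v \<noteq> 0" using z0 x assms(2) by (auto simp: v_def)
  have "v \<bullet> y \<le> v \<bullet> x" if "y \<in> P" for y
  proof -
    have "\<forall>y\<in>P. dist z0 x \<le> dist z0 y"
      unfolding dist using z0 by (auto intro: setdist_le_dist)
    from any_closest_point_dot[OF convex closed x that this] show ?thesis
      by (simp add: v_def inner_diff_right)
  qed
  have box: "v \<bullet> z0 \<le> v \<bullet> z" if "z \<in> cbox d c" for z
  proof -
    have "\<forall>z\<in>cbox d c. dist x z0 \<le> dist x z"
      unfolding dist_commute[of x] dist using x by (auto intro: setdist_le_dist)
    from any_closest_point_dot[OF convex_box(1) closed_cbox z0 that this] show ?thesis
      by (simp add: v_def inner_diff_right inner_diff_left)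
  qed
  obtain x1 x2 where x12: "x1 \<in> potential_polyhedron E1 \<gamma>1" "x2 \<in> potential_polyhedron E2 \<gamma>2" "x = x1 + x2"
    using x by (auto simp: P_eq)
  have v_cone: "v \<in> flow_cone E1 \<gamma>1 x1 E2 \<gamma>2 x2"
  proof -
    obtain p where p: "p \<in> flow_cone E1 \<gamma>1 x1 E2 \<gamma>2 x2"
      "\<And>j. p $ j < v $ j \<Longrightarrow> (x1 + x2) $ j = (x + 1) $ j"
      "\<And>j. v $ j < p $ j \<Longrightarrow> (x1 + x2) $ j = (x - 1) $ j"
    \<comment> \<open>a box that is not active at \<open>x\<close>\<close>
    proof (rule flow_cone_normal[OF x12(1,2), of "x - 1" "x + 1" v])
      show "x1 + x2 \<in> cbox (x - 1) (x + 1)" by (simp add: x12(3) mem_box_cart)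
      show "v \<bullet> (y1 + y2) \<le> v \<bullet> (x1 + x2)"
        if "y1 \<in> potential_polyhedron E1 \<gamma>1" "y2 \<in> potential_polyhedron E2 \<gamma>2" for y1 y2
        using \<open>\<And>y. y \<in> P \<Longrightarrow> v \<bullet> y \<le> v \<bullet> x\<close>[of "y1 + y2"] that x12(3) by (auto simp: P_eq)
    qed blast
    have "p $ j = v $ j" for j
      using p(2,3)[of j] by (cases "p $ j" "v $ j" rule: linorder_cases) (auto simp: x12(3))
    then have "p = v" by (simp add: vec_eq_iff)
    with p(1) show ?thesis by simp
  qed
  obtain B where B: "\<And>z. z \<in> cbox d c \<Longrightarrow> norm (z - x) \<le> B" "0 < B"
  proof -
    have "bounded ((\<lambda>z. z - x) ` cbox d c)" by (intro bounded_translation_minus bounded_cbox)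
    then show ?thesis using that by (auto simp: bounded_pos)
  qed
  \<comment> \<open>Chosen so that the gain \<open>t * (v \<bullet> v)\<close> exceeds by 1 the
    bound \<open>real CARD('n) * B\<close> on the effect of the rounding error.\<close>
  define t where "t = (real CARD('n) * B + 1) / (v \<bullet> v)"
  have "0 < v \<bullet> v" using \<open>v \<noteq> 0\<close> by simp
  then have "0 \<le> t" using B(2) by (simp add: t_def)
  obtain p where p: "p \<in> flow_cone E1 \<gamma>1 x1 E2 \<gamma>2 x2" "\<And>j. rounding ((t *\<^sub>R v) $ j) (p $ j)"
    using flow_cone_rounding[OF flow_cone_scaleR[OF v_cone \<open>0 \<le> t\<close>]] by blast
  show ?thesis
  proof (rule that[OF x12(1,2) p(1)])
    show "p $ j \<in> \<int>" for j using p(2) by (simp add: rounding_def)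
    fix z assume z: "z \<in> cbox d c"
    have "norm (p - t *\<^sub>R v) \<le> (\<Sum>j\<in>UNIV. \<bar>(p - t *\<^sub>R v) $ j\<bar>)" by (rule norm_le_l1_cart)
    also have "\<dots> \<le> (\<Sum>j\<in>(UNIV::'n set). 1)"
      using rounding_dist[OF p(2)] by (intro sum_mono) simp
    finally have "norm (p - t *\<^sub>R v) \<le> real CARD('n)" by simp
    then have "norm (p - t *\<^sub>R v) * norm (z - x) \<le> real CARD('n) * B"
      using B(1)[OF z] by (intro mult_mono) auto
    then have "- (real CARD('n) * B) \<le> (p - t *\<^sub>R v) \<bullet> (z - x)"
      using Cauchy_Schwarz_ineq2[of "p - t *\<^sub>R v" "z - x"] by linarith
    moreover have "real CARD('n) * B + 1 \<le> t * (v \<bullet> (z - x))"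
    proof -
      \<comment> \<open>Here \<open>v = z0 - x\<close>, and \<open>z0\<close> minimizes the product
        with \<open>v\<close> over the box.\<close>
      have "v \<bullet> v \<le> v \<bullet> (z - x)"
        using box[OF z] by (simp add: v_def inner_diff_right)
      then have "t * (v \<bullet> v) \<le> t * (v \<bullet> (z - x))"
        using \<open>0 \<le> t\<close> by (rule mult_left_mono)
      then show ?thesis using \<open>0 < v \<bullet> v\<close> by (simp add: t_def)
    qed
    moreover have "p \<bullet> (z - x) = (p - t *\<^sub>R v) \<bullet> (z - x) + t * (v \<bullet> (z - x))"
      by (simp add: inner_diff_left)
    ultimately have "0 < p \<bullet> (z - x)" by linarith
    then show "p \<bullet> (x1 + x2) < p \<bullet> z" by (simp add: x12(3) inner_diff_right)
  qed
qed

text \<open>A point outside \<open>P\<close> is a one-point box, so it is separated from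
  \<open>P\<close> by an integral normal vector. This vector is a nonnegative combination of rows,
  so the point violates some row.\<close>

lemma eq_solutions: "P = solutions attaining id support_value"
proof (intro equalityI subsetI)
  fix x assume "x \<in> P"
  then show "x \<in> solutions attaining id support_value"
    using support_value_eq by (fastforce simp: solutions_def attaining_def)
next
  fix y assume y: "y \<in> solutions attaining id support_value"
  show "y \<in> P"
  proof (rule ccontr)
    assume "y \<notin> P"
    then have "P \<inter> cbox y y = {}" "cbox y y \<noteq> {}" by auto
    then obtain x1 x2 p where p: "x1 \<in> potential_polyhedron E1 \<gamma>1" "x2 \<in> potential_polyhedron E2 \<gamma>2"
      "p \<in> flow_cone E1 \<gamma>1 x1 E2 \<gamma>2 x2" "\<And>j. p $ j \<in> \<int>"
      "\<And>z. z \<in> cbox y y \<Longrightarrow> p \<bullet> (x1 + x2) < p \<bullet> z"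
      using separation_from_box[of y y] by metis
    obtain k :: "real^'n \<Rightarrow> nat" where k: "p = (\<Sum>w\<in>attaining. real (k w) *\<^sub>R w)"
      "(\<Sum>w\<in>attaining. real (k w) * support_value w) = p \<bullet> (x1 + x2)"
      using flow_cone_integral_combination[OF p(1-4)] by blast
    have "p \<bullet> y = (\<Sum>w\<in>attaining. real (k w) * (w \<bullet> y))"
      by (simp add: k(1) inner_sum_left)
    also have "\<dots> \<le> (\<Sum>w\<in>attaining. real (k w) * support_value w)"
      using y by (intro sum_mono mult_left_mono) (auto simp: solutions_def)
    finally show False using p(5)[of y] k(2) by simp
  qed
qed

lemma solutions_enumeration:
  assumes "bij_betw e I attaining"
  shows "solutions I e (support_value \<circ> e) = P"
proof -
  have "attaining = e ` I" using assms by (simp add: bij_betw_def)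
  then show ?thesis by (subst eq_solutions) (simp add: solutions_def)
qed

text \<open>A finite dual minimum forces \<open>P\<close> to meet the box, so the maximum is
  attained at some \<open>x\<close>. Rounding the component of \<open>q\<close> in the normal cone
  of \<open>P\<close> at \<open>x\<close> gives integral multipliers for the rows, and the positive
  and negative parts of the remainder give those for the box. Their dual value is
  \<open>q \<bullet> x\<close>, so weak duality proves optimality.\<close>

lemma box_TDI_enumeration:
  fixes e :: "'i \<Rightarrow> real^'n"
  assumes I: "finite I" "bij_betw e I attaining"
    and rat: "\<And>w. w \<in> attaining \<Longrightarrow> support_value w \<in> \<rat>"
  shows "box_TDI I e (support_value \<circ> e)"
  unfolding box_TDI_def TDI_def
proof (intro allI impI conjI)
  fix d c :: "real^'n"
  assume dc: "(\<forall>j. d $ j \<in> \<rat>) \<and> (\<forall>j. c $ j \<in> \<rat>)"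
  let ?I = "box_index I" and ?A = "box_rows e" and ?b = "box_rhs (support_value \<circ> e) d c"
  have e: "e i \<in> attaining" if "i \<in> I" for i
    using I(2) that by (auto simp: bij_betw_def)
  have "e i $ j \<in> \<rat>" if "i \<in> I" for i j
  proof -
    have "e i $ j \<in> {-1, 0, 1}" using e[OF that] by (simp add: attaining_def ternary_vectors_def)
    then show ?thesis by auto
  qed
  then show "rational_system ?I ?A ?b"
    using I(1) dc rat e by (intro rational_system_box) (auto simp: rational_system_def)
  fix q :: "real^'n"
  assume q: "(\<forall>j. q $ j \<in> \<int>) \<and> dual_min_finite ?I ?A ?b q"
  have reindex: "(\<Sum>i\<in>I. F (e i)) = (\<Sum>w\<in>attaining. F w)" for F :: "_ \<Rightarrow> 'a::comm_monoid_add"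
    using I(2) by (rule sum.reindex_bij_betw)
  have "cbox d c \<noteq> {}"
  proof
    assume "cbox d c = {}"
    then obtain j where j: "c $ j < d $ j"
      by (auto simp: interval_eq_empty_cart)
    \<comment> \<open>The upper and lower bound rows of coordinate \<open>j\<close> cancel, and
      their right-hand sides sum to the negative number \<open>c $ j - d $ j\<close>.\<close>
    have "dual_feasible ?I ?A 0 (box_dual (\<lambda>_. 0) (axis j 1) (axis j 1))"
      using I(1) by (intro dual_feasible_box_dual) (auto simp: axis_def)
    moreover have "dual_value ?I ?b (box_dual (\<lambda>_. 0) (axis j 1) (axis j 1)) < 0"
      using j I(1) by (simp add: dual_value_box_dual inner_axis')
    ultimately show False
      using dual_ray_unbounded q by blast
  qed
  moreover have "P \<inter> cbox d c \<noteq> {}"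
  proof
    assume "P \<inter> cbox d c = {}"
    with \<open>cbox d c \<noteq> {}\<close> obtain x1 x2 p where
      p: "x1 \<in> potential_polyhedron E1 \<gamma>1" "x2 \<in> potential_polyhedron E2 \<gamma>2"
      "p \<in> flow_cone E1 \<gamma>1 x1 E2 \<gamma>2 x2" "\<And>j. p $ j \<in> \<int>"
      "\<And>z. z \<in> cbox d c \<Longrightarrow> p \<bullet> (x1 + x2) < p \<bullet> z"
      using separation_from_box by metis
    obtain k :: "real^'n \<Rightarrow> nat" where k: "p = (\<Sum>w\<in>attaining. real (k w) *\<^sub>R w)"
      "(\<Sum>w\<in>attaining. real (k w) * support_value w) = p \<bullet> (x1 + x2)"
      using flow_cone_integral_combination[OF p(1-4)] by blast
    \<comment> \<open>The multipliers \<open>s\<close> and \<open>t\<close> cancel the row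
      combination \<open>p\<close>, and \<open>z\<close> is a corner of the box minimizing
      \<open>p\<close>; the value of the resulting ray is
      \<open>p \<bullet> (x1 + x2) - p \<bullet> z\<close>.\<close>
    define s t z :: "real^'n"
      where "s = (\<chi> j. max (- p $ j) 0)" and "t = (\<chi> j. max (p $ j) 0)"
        and "z = (\<chi> j. if 0 \<le> p $ j then d $ j else c $ j)"
    let ?y = "box_dual (\<lambda>i. real (k (e i))) s t"
    have "dual_feasible ?I ?A 0 ?y"
      using I(1)
      by (intro dual_feasible_box_dual)
        (auto simp: reindex[of "\<lambda>w. real (k w) *\<^sub>R w"] k(1)[symmetric] s_def t_def vec_eq_iff)
    moreover have "z \<in> cbox d c"
      using \<open>cbox d c \<noteq> {}\<close> by (auto simp: z_def mem_box_cart interval_eq_empty_cart not_less)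
    moreover have "s \<bullet> c - t \<bullet> d = - (p \<bullet> z)"
      unfolding inner_vec_def sum_subtractf[symmetric] sum_negf[symmetric]
      by (intro sum.cong) (auto simp: s_def t_def z_def max_def)
    then have "dual_value ?I ?b ?y = p \<bullet> (x1 + x2) - p \<bullet> z"
      using I(1) by (simp add: dual_value_box_dual k(2)[symmetric]
          reindex[of "\<lambda>w. real (k w) * support_value w"])
    ultimately show False
      using dual_ray_unbounded[of ?I ?A ?y ?b q] p(5)[of z] q by auto
  qed
  moreover have "compact (P \<inter> cbox d c)"
    using closed by (simp add: closed_Int_compact)
  moreover have "continuous_on (P \<inter> cbox d c) (\<lambda>y. q \<bullet> y)"
    by (intro continuous_intros)
  ultimately obtain x where x: "x \<in> P" "x \<in> cbox d c"
    and opt: "\<And>y. y \<in> P \<Longrightarrow> y \<in> cbox d c \<Longrightarrow> q \<bullet> y \<le> q \<bullet> x"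
    using continuous_attains_sup[of "P \<inter> cbox d c" "\<lambda>y. q \<bullet> y"] by blast
  obtain x1 x2 where x12: "x1 \<in> potential_polyhedron E1 \<gamma>1" "x2 \<in> potential_polyhedron E2 \<gamma>2" "x = x1 + x2"
    using x(1) by (auto simp: P_eq)
  obtain p0 where p0: "p0 \<in> flow_cone E1 \<gamma>1 x1 E2 \<gamma>2 x2"
    "\<And>j. p0 $ j < q $ j \<Longrightarrow> (x1 + x2) $ j = c $ j" "\<And>j. q $ j < p0 $ j \<Longrightarrow> (x1 + x2) $ j = d $ j"
  proof (rule flow_cone_normal[OF x12(1,2), of d c q])
    show "x1 + x2 \<in> cbox d c" using x(2) x12(3) by simp
    show "q \<bullet> (y1 + y2) \<le> q \<bullet> (x1 + x2)"
      if "y1 \<in> potential_polyhedron E1 \<gamma>1" "y2 \<in> potential_polyhedron E2 \<gamma>2" "y1 + y2 \<in> cbox d c" for y1 y2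
      using opt[of "y1 + y2"] that x12(3) by (auto simp: P_eq)
  qed blast
  obtain p where p: "p \<in> flow_cone E1 \<gamma>1 x1 E2 \<gamma>2 x2" "\<And>j. rounding (p0 $ j) (p $ j)"
    using flow_cone_rounding[OF p0(1)] by blast
  have p_int: "p $ j \<in> \<int>" for j using p(2) by (simp add: rounding_def)
  obtain k :: "real^'n \<Rightarrow> nat" where k: "p = (\<Sum>w\<in>attaining. real (k w) *\<^sub>R w)"
    "(\<Sum>w\<in>attaining. real (k w) * support_value w) = p \<bullet> (x1 + x2)"
    using flow_cone_integral_combination[OF x12(1,2) p(1) p_int] by blast
  define s t :: "real^'n" where "s = (\<chi> j. max (q $ j - p $ j) 0)" and "t = (\<chi> j. max (p $ j - q $ j) 0)"
  let ?y = "box_dual (\<lambda>i. real (k (e i))) s t"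
  \<comment> \<open>Because \<open>q $ j\<close> is an integer, \<open>p $ j < q $ j\<close> already
    forces \<open>p0 $ j < q $ j\<close>, so the bound is active. The lower bounds are
    symmetric.\<close>
  have upper: "x $ j = c $ j" if "p $ j < q $ j" for j
    using that p0(2)[of j] rounding_ge[OF p(2), of "q $ j" j] q x12(3) by (meson not_le)
  have lower: "x $ j = d $ j" if "q $ j < p $ j" for j
    using that p0(3)[of j] rounding_le[OF p(2), of "q $ j" j] q x12(3) by (meson not_le)
  have feasible: "dual_feasible ?I ?A q ?y"
    using I(1)
    by (intro dual_feasible_box_dual)
      (auto simp: reindex[of "\<lambda>w. real (k w) *\<^sub>R w"] k(1)[symmetric] s_def t_def vec_eq_iff)
  \<comment> \<open>Entries of \<open>s\<close> are nonzero only where \<open>x\<close> meets its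
    upper bound, entries of \<open>t\<close> only where it meets its lower bound.\<close>
  have "s \<bullet> c - t \<bullet> d = (q - p) \<bullet> x"
    unfolding inner_vec_def sum_subtractf[symmetric]
    using upper lower by (intro sum.cong) (auto simp: s_def t_def max_def algebra_simps not_le)
  then have value_eq: "dual_value ?I ?b ?y = q \<bullet> x"
    using I(1) by (simp add: dual_value_box_dual k(2) x12(3)
        reindex[of "\<lambda>w. real (k w) * support_value w"] inner_diff_left)
  have "x \<in> solutions ?I ?A ?b"
    using x by (simp add: solutions_box solutions_enumeration[OF I(2)])
  then have "dual_optimal ?I ?A ?b q ?y"
    using feasible value_eq weak_duality by (auto simp: dual_optimal_def)
  moreover have "\<forall>i\<in>?I. ?y i \<in> \<int>"
    using p_int q
    by (auto simp: box_index_def box_dual_def s_def t_def max_def intro!: Ints_diff split: sum.split)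
  ultimately show "\<exists>y. (\<forall>i\<in>?I. y i \<in> \<int>) \<and> dual_optimal ?I ?A ?b q y"
    by blast
qed

text \<open>The rows have entries -1, 0 and 1. Rationality of \<open>P\<close> makes the right-hand
  sides rational, as optimal values of rational linear programs.\<close>

lemma box_TDI_polyhedron:
  assumes "rational_polyhedron P"
  shows "box_TDI_polyhedron P"
proof -
  obtain m' A b where sys: "rational_system {..<m'::nat} A b" "P = solutions {..<m'} A b"
    using assms by (auto simp: rational_polyhedron_def)
  have rat: "support_value w \<in> \<rat>" if w: "w \<in> attaining" for w
  proof -
    obtain x where x: "x \<in> P" "\<And>y. y \<in> P \<Longrightarrow> w \<bullet> y \<le> w \<bullet> x"
      using w by (auto simp: attaining_def)
    have "w $ j \<in> {-1, 0, 1}" for j using w by (simp add: attaining_def ternary_vectors_def)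
    then have "w $ j \<in> \<rat>" for j by (metis Rats_0 Rats_1 Rats_minus_iff insertE singletonD)
    then have "w \<bullet> x \<in> \<rat>"
      using rational_system_optimum_in_Rats[OF sys(1), of w x] x sys(2) by blast
    then show ?thesis using support_value_eq[OF x] by simp
  qed
  have "finite attaining"
    by (rule finite_subset[OF _ finite_ternary_vectors]) (auto simp: attaining_def)
  then obtain e where e: "bij_betw e {..<card attaining} attaining"
    using ex_bij_betw_nat_finite[of attaining] by (auto simp: atLeast0LessThan)
  then have "box_TDI {..<card attaining} e (support_value \<circ> e)"
    using box_TDI_enumeration rat by blast
  then show ?thesis
    using solutions_enumeration[OF e] unfolding box_TDI_polyhedron_def by metis
qed

end

text \<open>The empty set is described by the single contradictory row with coefficients 0 and
  right-hand side -1. Multiplier 1 on this row is a dual ray of value -1, so no dual minimum is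
  finite and the integrality condition holds vacuously.\<close>

lemma box_TDI_polyhedron_empty: "box_TDI_polyhedron ({} :: (real^'n) set)"
proof -
  let ?A = "\<lambda>_::nat. 0 :: real^'n" and ?b = "\<lambda>_::nat. - 1 :: real"
  have "TDI (box_index {..<1}) (box_rows ?A) (box_rhs ?b d c)"
    if dc: "\<forall>j. d $ j \<in> \<rat>" "\<forall>j. c $ j \<in> \<rat>" for d c
  proof -
    have "rational_system (box_index {..<1}) (box_rows ?A) (box_rhs ?b d c)"
      using dc by (intro rational_system_box) (auto simp: rational_system_def)
    moreover have "\<not> dual_min_finite (box_index {..<1}) (box_rows ?A) (box_rhs ?b d c) q" for q
      by (rule dual_ray_unbounded[of _ _ "box_dual (\<lambda>_. 1) 0 0"])
        (auto simp: dual_value_box_dual intro!: dual_feasible_box_dual)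
    ultimately show ?thesis by (simp add: TDI_def)
  qed
  then have "box_TDI {..<1} ?A ?b" by (simp add: box_TDI_def)
  moreover have "{} = solutions {..<1} ?A ?b" by (simp add: solutions_def)
  ultimately show ?thesis unfolding box_TDI_polyhedron_def by blast
qed

lemma L2_convex_imp_L2_natural_convex: "L2_convex P \<Longrightarrow> L2_natural_convex P"
  unfolding L2_convex_def L2_natural_convex_def using L_convex_imp_L_natural_convex by blast

lemma L2_natural_convex_imp_box_TDI_polyhedron:
  fixes P :: "(real^'n) set"
  assumes "rational_polyhedron P" "L2_natural_convex P"
  shows "box_TDI_polyhedron P"
proof (cases "P = {}")
  case True
  then show ?thesis by (simp add: box_TDI_polyhedron_empty)
next
  case False
  obtain P1 P2 where P: "L_natural_convex P1" "L_natural_convex P2" "polyhedron P"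
    "P = {x + y |x y. x \<in> P1 \<and> y \<in> P2}"
    using assms(2) by (auto simp: L2_natural_convex_def)
  with False have "P1 \<noteq> {}" "P2 \<noteq> {}" by auto
  with P obtain E1 \<gamma>1 E2 \<gamma>2 where "P1 = potential_polyhedron E1 \<gamma>1" "P2 = potential_polyhedron E2 \<gamma>2"
    by (metis L_natural_convex_differences)
  with P False interpret potential_sum P E1 \<gamma>1 E2 \<gamma>2
    by unfold_locales (auto simp: polyhedron_imp_closed polyhedron_imp_convex)
  show ?thesis using assms(1) by (rule box_TDI_polyhedron)
qed

theorem theorem5p1:
  fixes P :: "(real^'n) set"
  assumes "rational_polyhedron P"
  shows "(L2_convex P \<longrightarrow> box_TDI_polyhedron P) \<and> (L2_natural_convex P \<longrightarrow> box_TDI_polyhedron P)"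
  using assms L2_natural_convex_imp_box_TDI_polyhedron L2_convex_imp_L2_natural_convex by blast

end
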